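(* Let $\mathcal{A}$ and $\mathcal{B}$ be unital $C^*$-algebras, $\phi:\mathcal{A}\to\mathcal{B}$ a positive unital linear map, and $f:I\to\mathbb{R}$ a convex function defined on some open interval $I\subseteq\mathbb{R}$. Let $a\in\mathcal{A}$ be self-adjoint with spectrum contained in $I$. If $\phi(a)$ and $\phi(f(a))$ commute, then $$f(\phi(a))\leq\phi(f(a)).$$ Moreover, if $0\in I$ and $f(0)\leq 0$, then the same inequality holds (under the same commutation hypothesis) when the positive linear map $\phi$ is only assumed to be contractive instead of unital.
   Context: A linear map between $C^*$-algebras is positive if it maps positive elements to positive elements; it is contractive if its norm is at most $1$. $f(x)$ for self-adjoint $x$ is defined by continuous functional calculus. The order $\leq$ is the usual order on self-adjoint elements of a $C^*$-algebra. *)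

theory Defs
  imports "HOL-Analysis.Analysis"
begin

text \<open>
  The norm, the completeness and the real scalar multiplication are those of the library classes.
  The class \<open>real_normed_algebra_1\<close> is not used because it
  excludes the zero algebra; \<open>norm 1 = 1\<close> follows from the \<open>C\<^sup>*\<close>-identity unless \<open>1 = 0\<close>.
\<close>

class unital_cstar_algebra = real_normed_algebra + banach + monoid_mult +
  fixes scaleC :: "complex \<Rightarrow> 'a \<Rightarrow> 'a" (infixr "*\<^sub>C" 75)
    and star :: "'a \<Rightarrow> 'a"
  assumes scaleC_add_right: "c *\<^sub>C (x + y) = c *\<^sub>C x + c *\<^sub>C y"
    and scaleC_add_left: "(c + d) *\<^sub>C x = c *\<^sub>C x + d *\<^sub>C x"
    and scaleC_scaleC: "c *\<^sub>C d *\<^sub>C x = (c * d) *\<^sub>C x"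
    and scaleC_of_real: "complex_of_real r *\<^sub>C x = r *\<^sub>R x"
    and norm_scaleC: "norm (c *\<^sub>C x) = cmod c * norm x"
    and mult_scaleC_left: "(c *\<^sub>C x) * y = c *\<^sub>C (x * y)"
    and mult_scaleC_right: "x * (c *\<^sub>C y) = c *\<^sub>C (x * y)"
    and star_add: "star (x + y) = star x + star y"
    and star_scaleC: "star (c *\<^sub>C x) = cnj c *\<^sub>C star x"
    and star_mult: "star (x * y) = star y * star x"
    and star_star: "star (star x) = x"
    and cstar_identity: "norm (star x * x) = (norm x)\<^sup>2"

definition selfadjoint :: "'a::unital_cstar_algebra \<Rightarrow> bool" where
  "selfadjoint x \<longleftrightarrow> star x = x"

definition invertible_elem :: "'a::unital_cstar_algebra \<Rightarrow> bool" where
  "invertible_elem x \<longleftrightarrow> (\<exists>y. x * y = 1 \<and> y * x = 1)"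

definition spectrum :: "'a::unital_cstar_algebra \<Rightarrow> complex set" where
  "spectrum x = {c. \<not> invertible_elem (x - c *\<^sub>C 1)}"

definition positive_elem :: "'a::unital_cstar_algebra \<Rightarrow> bool" where
  "positive_elem x \<longleftrightarrow> selfadjoint x \<and> spectrum x \<subseteq> complex_of_real ` {0..}"

definition cstar_le :: "'a::unital_cstar_algebra \<Rightarrow> 'a \<Rightarrow> bool" (infix "\<preceq>" 50) where
  "x \<preceq> y \<longleftrightarrow> selfadjoint x \<and> selfadjoint y \<and> positive_elem (y - x)"

definition complex_linear ::
  "('a::unital_cstar_algebra \<Rightarrow> 'b::unital_cstar_algebra) \<Rightarrow> bool" where
  "complex_linear \<phi> \<longleftrightarrow>
     (\<forall>x y. \<phi> (x + y) = \<phi> x + \<phi> y) \<and> (\<forall>c x. \<phi> (c *\<^sub>C x) = c *\<^sub>C \<phi> x)"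

definition positive_map ::
  "('a::unital_cstar_algebra \<Rightarrow> 'b::unital_cstar_algebra) \<Rightarrow> bool" where
  "positive_map \<phi> \<longleftrightarrow> (\<forall>x. positive_elem x \<longrightarrow> positive_elem (\<phi> x))"

text \<open>Boundedness has to be required separately: \<open>onorm\<close> is meaningless for unbounded maps.\<close>

definition contractive ::
  "('a::unital_cstar_algebra \<Rightarrow> 'b::unital_cstar_algebra) \<Rightarrow> bool" where
  "contractive \<phi> \<longleftrightarrow> bounded_linear \<phi> \<and> onorm \<phi> \<le> 1"

text \<open>
  \<open>\<Phi>\<close> is an isometric unital \<open>*\<close>-homomorphism from the algebra \<open>C(spectrum x)\<close> of continuous
  functions, with the supremum norm, that sends the identity function to \<open>x\<close>. Elements of
  \<open>C(spectrum x)\<close> are represented by total functions that are continuous on the spectrum; the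
  isometry condition makes \<open>\<Phi> g\<close> depend only on the values of \<open>g\<close> there. It is written with
  bounds \<open>M\<close> rather than a supremum since the spectrum is empty in the zero algebra.
\<close>

definition is_functional_calculus ::
  "'a::unital_cstar_algebra \<Rightarrow> ((complex \<Rightarrow> complex) \<Rightarrow> 'a) \<Rightarrow> bool" where
  "is_functional_calculus x \<Phi> \<longleftrightarrow>
     (\<forall>g h. continuous_on (spectrum x) g \<longrightarrow> continuous_on (spectrum x) h \<longrightarrow>
        \<Phi> (\<lambda>z. g z + h z) = \<Phi> g + \<Phi> h \<and> \<Phi> (\<lambda>z. g z * h z) = \<Phi> g * \<Phi> h) \<and>
     (\<forall>c g. continuous_on (spectrum x) g \<longrightarrow> \<Phi> (\<lambda>z. c * g z) = c *\<^sub>C \<Phi> g) \<and>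
     (\<forall>g. continuous_on (spectrum x) g \<longrightarrow> \<Phi> (\<lambda>z. cnj (g z)) = star (\<Phi> g)) \<and>
     (\<forall>g M. continuous_on (spectrum x) g \<longrightarrow> 0 \<le> M \<longrightarrow>
        (norm (\<Phi> g) \<le> M \<longleftrightarrow> (\<forall>z\<in>spectrum x. cmod (g z) \<le> M))) \<and>
     \<Phi> (\<lambda>z. 1) = 1 \<and> \<Phi> (\<lambda>z. z) = x"

text \<open>
  The calculus exists and is unique on continuous functions whenever \<open>x\<close> is normal;
  \<open>cfc\<close> is meaningful only then, and only for \<open>g\<close> continuous on the spectrum.
\<close>

definition cfc :: "(complex \<Rightarrow> complex) \<Rightarrow> 'a::unital_cstar_algebra \<Rightarrow> 'a" where
  "cfc g x = (THE y. \<exists>\<Phi>. is_functional_calculus x \<Phi> \<and> y = \<Phi> g)"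

text \<open>For self-adjoint \<open>x\<close> the spectrum is real, so a real function of a real variable suffices.\<close>

definition cfc_real :: "(real \<Rightarrow> real) \<Rightarrow> 'a::unital_cstar_algebra \<Rightarrow> 'a" where
  "cfc_real f x = cfc (\<lambda>z. complex_of_real (f (Re z))) x"

end

theory Submission
  imports Defs "HOL-Computational_Algebra.Fundamental_Theorem_Algebra"
begin

text \<open>
  Write \<open>b = \<phi>(a)\<close> and \<open>c = \<phi>(f(a))\<close>. Through every point \<open>(s, f(s))\<close> with \<open>s \<in> I\<close> there is a
  supporting line \<open>l(t) = m t + k \<le> f(t)\<close>. The functional calculus gives \<open>l(a) \<le> f(a)\<close>, and
  positivity of \<open>\<phi>\<close> gives \<open>m b + k \<phi>(1) \<le> c\<close>. If \<open>\<phi>\<close> is unital, this says \<open>l(b) \<le> c\<close>. If \<open>\<phi>\<close> is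
  contractive, then \<open>\<phi>(1) \<le> 1\<close>, while \<open>k = l(0) \<le> f(0) \<le> 0\<close>, so that \<open>k 1 \<le> k \<phi>(1)\<close> and again
  \<open>l(b) \<le> c\<close>. The same comparison with \<open>\<phi>(1)\<close> shows that the spectrum of \<open>b\<close> lies in \<open>I\<close>
  (\<open>map_spectrum_subset\<close>).

  Since \<open>b\<close> and \<open>c\<close> commute, they behave like functions, and \<open>f\<close> is the pointwise supremum of its
  supporting lines; hence \<open>f(b) \<le> c\<close>. Lemma \<open>cfc_real_le_commuting\<close> makes this precise without
  Gelfand theory: \<open>c - f(b) + \<epsilon>\<close> is multiplied by a positive invertible function of \<open>b\<close>, a finite sum of
  weights localized where a supporting line is within \<open>\<epsilon>\<close> of \<open>f\<close>, and the product is positive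
  because products of commuting positive elements are positive.

  The rest is the theory of a single self-adjoint element \<open>x\<close>. Its spectrum is real, and its norm is
  attained on the spectrum (\<open>selfadjoint_norm_attained\<close>). With spectral mapping for polynomials this
  yields \<open>\<parallel>p(x)\<parallel> \<le> M\<close> iff \<open>\<bar>p\<bar> \<le> M\<close> on the spectrum (\<open>norm_poly_elem_le_iff\<close>), and by the Weierstrass
  theorem existence and uniqueness of the continuous functional calculus (\<open>calculus_value_cfc\<close>).
  Positivity of \<open>x\<close> is equivalent to \<open>\<parallel>x - t\<parallel> \<le> t\<close> for some \<open>t \<ge> 0\<close> (\<open>positive_elem_norm_iff\<close>), which
  shows that sums of positive elements are positive.
\<close>

section \<open>Scalars and involution\<close>

lemma scaleC_one [simp]: "1 *\<^sub>C x = (x::'a::unital_cstar_algebra)"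
  using scaleC_of_real[of 1 x] by simp

lemma scaleC_zero_left [simp]: "0 *\<^sub>C x = (0::'a::unital_cstar_algebra)"
  using scaleC_of_real[of 0 x] by simp

lemma scaleC_zero_right [simp]: "c *\<^sub>C 0 = (0::'a::unital_cstar_algebra)"
  using norm_scaleC[of c "0::'a"] by simp

lemma scaleC_minus_left: "(-c) *\<^sub>C x = - (c *\<^sub>C (x::'a::unital_cstar_algebra))"
  using scaleC_add_left[of "-c" c x] by (simp add: eq_neg_iff_add_eq_0)

lemma scaleC_minus_right: "c *\<^sub>C (- x) = - (c *\<^sub>C (x::'a::unital_cstar_algebra))"
  using scaleC_add_right[of c "-x" x] by (simp add: eq_neg_iff_add_eq_0)

lemma scaleC_diff_left: "(c - d) *\<^sub>C x = c *\<^sub>C x - d *\<^sub>C (x::'a::unital_cstar_algebra)"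
  using scaleC_add_left[of c "-d" x] by (simp add: scaleC_minus_left)

lemma scaleC_diff_right: "c *\<^sub>C (x - y) = c *\<^sub>C x - c *\<^sub>C (y::'a::unital_cstar_algebra)"
  using scaleC_add_right[of c x "-y"] by (simp add: scaleC_minus_right)

lemma scaleC_scaleR: "c *\<^sub>C (r *\<^sub>R x) = r *\<^sub>R (c *\<^sub>C (x::'a::unital_cstar_algebra))"
  by (simp add: scaleC_of_real[symmetric] scaleC_scaleC mult.commute)

lemma bounded_linear_scaleC: "bounded_linear (\<lambda>x::'a::unital_cstar_algebra. c *\<^sub>C x)"
  by (rule bounded_linear_intro[where K = "cmod c"])
     (simp_all add: scaleC_add_right scaleC_scaleR norm_scaleC mult.commute)

lemma star_zero [simp]: "star (0::'a::unital_cstar_algebra) = 0"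
  using star_scaleC[of 0 "0::'a"] by simp

lemma star_minus: "star (- x) = - star (x::'a::unital_cstar_algebra)"
  using star_add[of x "-x"] by (simp add: eq_neg_iff_add_eq_0 add.commute)

lemma star_diff: "star (x - y) = star x - star (y::'a::unital_cstar_algebra)"
  using star_add[of x "-y"] by (simp add: star_minus)

lemma star_scaleR: "star (r *\<^sub>R x) = r *\<^sub>R star (x::'a::unital_cstar_algebra)"
  by (simp add: scaleC_of_real[symmetric] star_scaleC)

lemma star_one [simp]: "star (1::'a::unital_cstar_algebra) = 1"
  by (metis mult_1_left mult_1_right star_mult star_star)

lemma norm_star [simp]: "norm (star x) = norm (x::'a::unital_cstar_algebra)"
proof -
  have le: "norm y \<le> norm (star y)" for y :: 'a
  proof (cases "y = 0")
    case False
    have "norm y * norm y \<le> norm (star y) * norm y"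
      using cstar_identity[of y] norm_mult_ineq[of "star y" y] by (simp add: power2_eq_square)
    then show ?thesis using False by simp
  qed simp
  show ?thesis using le[of x] le[of "star x"] by (simp add: star_star)
qed

text \<open>The norm of the unit is \<open>1\<close>, except in the zero algebra, where it is \<open>0\<close>.\<close>

lemma norm_one_le: "norm (1::'a::unital_cstar_algebra) \<le> 1"
proof -
  have "norm (1::'a) = norm (1::'a) * norm (1::'a)"
    using cstar_identity[of "1::'a"] by (simp add: power2_eq_square)
  then show ?thesis by (metis mult_cancel_right1 order_refl zero_le_one)
qed

lemma norm_power_le: "norm ((x::'a::unital_cstar_algebra) ^ n) \<le> norm x ^ n"
proof (induction n)
  case 0
  then show ?case using norm_one_le by simp
next
  case (Suc n)
  have "norm (x ^ Suc n) \<le> norm x * norm (x ^ n)" using norm_mult_ineq by simp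
  also have "\<dots> \<le> norm x * norm x ^ n" using Suc by (intro mult_left_mono) auto
  finally show ?case by simp
qed

lemma bounded_linear_star: "bounded_linear (star :: 'a::unital_cstar_algebra \<Rightarrow> 'a)"
  by (rule bounded_linear_intro[where K = 1]) (simp_all add: star_add star_scaleR)

lemma selfadjoint_one [simp]: "selfadjoint (1::'a::unital_cstar_algebra)"
  by (simp add: selfadjoint_def)

lemma selfadjoint_add: "selfadjoint x \<Longrightarrow> selfadjoint y \<Longrightarrow> selfadjoint (x + y)"
  and selfadjoint_diff: "selfadjoint x \<Longrightarrow> selfadjoint y \<Longrightarrow> selfadjoint (x - y)"
  and selfadjoint_minus: "selfadjoint x \<Longrightarrow> selfadjoint (- x)"
  and selfadjoint_scaleR: "selfadjoint x \<Longrightarrow> selfadjoint (r *\<^sub>R x)"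
  by (simp_all add: selfadjoint_def star_add star_diff star_minus star_scaleR)

lemma selfadjoint_mult: "selfadjoint x \<Longrightarrow> selfadjoint y \<Longrightarrow> x * y = y * x \<Longrightarrow> selfadjoint (x * y)"
  by (simp add: selfadjoint_def star_mult)

lemma selfadjoint_power: "selfadjoint x \<Longrightarrow> selfadjoint (x ^ n)"
  by (induction n) (simp_all add: selfadjoint_def star_mult power_commutes)


section \<open>Invertible elements and the spectrum\<close>

lemma invertible_elemI:
  assumes "x * y = 1" and "z * x = (1::'a::unital_cstar_algebra)"
  shows "invertible_elem x"
proof -
  have "z = y" by (metis assms mult.assoc mult_1_left mult_1_right)
  then show ?thesis using assms unfolding invertible_elem_def by blast
qed

lemma invertible_elem_mult:
  assumes "invertible_elem x" "invertible_elem y"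
  shows "invertible_elem (x * y)"
proof -
  obtain x' y' where *: "x * x' = 1" "x' * x = 1" "y * y' = 1" "y' * y = 1"
    using assms unfolding invertible_elem_def by blast
  have "x * y * (y' * x') = 1" "y' * x' * (x * y) = 1"
    by (metis "*" mult.assoc mult_1_right)+
  then show ?thesis by (rule invertible_elemI)
qed

lemma invertible_elem_mult_commuting:
  assumes "x * y = y * x"
  shows "invertible_elem (x * y) \<longleftrightarrow> invertible_elem x \<and> invertible_elem y"
proof
  assume "invertible_elem (x * y)"
  then obtain z where z: "x * y * z = 1" "z * (x * y) = 1"
    unfolding invertible_elem_def by blast
  have "x * (y * z) = 1" "(z * y) * x = 1" "y * (x * z) = 1" "(z * x) * y = 1"
    using z assms by (metis mult.assoc)+
  then show "invertible_elem x \<and> invertible_elem y" by (blast intro: invertible_elemI)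
qed (simp add: invertible_elem_mult)

lemma invertible_elem_one [simp]: "invertible_elem (1::'a::unital_cstar_algebra)"
  by (rule invertible_elemI[of _ 1 1]) simp_all

lemma invertible_elem_scaleC:
  assumes "c \<noteq> 0"
  shows "invertible_elem (c *\<^sub>C x) \<longleftrightarrow> invertible_elem x"
proof -
  have *: "invertible_elem (c *\<^sub>C x)" if inv: "invertible_elem x" and c: "c \<noteq> 0" for c and x :: 'a
  proof -
    obtain y where "x * y = 1" "y * x = 1" using inv unfolding invertible_elem_def by blast
    then have "c *\<^sub>C x * (inverse c *\<^sub>C y) = 1" "inverse c *\<^sub>C y * c *\<^sub>C x = 1"
      using c by (simp_all add: mult_scaleC_left mult_scaleC_right scaleC_scaleC)
    then show ?thesis by (rule invertible_elemI)
  qed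
  show ?thesis using *[of x c] *[of "c *\<^sub>C x" "inverse c"] assms by (auto simp: scaleC_scaleC)
qed

lemma invertible_elem_minus: "invertible_elem (- x) \<longleftrightarrow> invertible_elem x"
  using invertible_elem_scaleC[of "-1" x] by (simp add: scaleC_minus_left)

text \<open>The Neumann series.\<close>

lemma invertible_elem_one_minus:
  assumes "norm (x::'a::unital_cstar_algebra) < 1"
  shows "invertible_elem (1 - x)"
proof -
  have "summable (\<lambda>n. norm x ^ n)" using assms by (simp add: summable_geometric)
  then have sm: "summable (\<lambda>n. x ^ n)"
    by (rule summable_comparison_test'[where N = 0]) (simp add: norm_power_le)
  have shift: "(\<Sum>n. x ^ n) = 1 + (\<Sum>n. x ^ Suc n)"
    using suminf_split_head[OF sm] by (simp add: algebra_simps)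
  have l: "(\<Sum>n. x ^ Suc n) = x * (\<Sum>n. x ^ n)"
    using bounded_linear.suminf[OF bounded_linear_mult_right sm, of x] by simp
  have r: "(\<Sum>n. x ^ Suc n) = (\<Sum>n. x ^ n) * x"
    using bounded_linear.suminf[OF bounded_linear_mult_left sm, of x] by (simp add: power_commutes)
  have "(1 - x) * (\<Sum>n. x ^ n) = 1" "(\<Sum>n. x ^ n) * (1 - x) = 1"
    using shift l r by (simp_all add: algebra_simps)
  then show ?thesis by (rule invertible_elemI)
qed

lemma mem_spectrum: "c \<in> spectrum x \<longleftrightarrow> \<not> invertible_elem (x - c *\<^sub>C 1)"
  by (simp add: spectrum_def)

lemma spectrum_norm_le:
  assumes "c \<in> spectrum (x::'a::unital_cstar_algebra)"
  shows "cmod c \<le> norm x"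
proof (rule ccontr)
  assume a: "\<not> ?thesis"
  then have c: "c \<noteq> 0" by auto
  have "norm (inverse c *\<^sub>C x) < 1"
    using a c by (simp add: norm_scaleC norm_inverse divide_inverse_commute[symmetric])
  then have "invertible_elem (1 - inverse c *\<^sub>C x)" by (rule invertible_elem_one_minus)
  then have "invertible_elem ((-c) *\<^sub>C (1 - inverse c *\<^sub>C x))"
    using c by (subst invertible_elem_scaleC) auto
  moreover have "(-c) *\<^sub>C (1 - inverse c *\<^sub>C x) = x - c *\<^sub>C 1"
    using c by (simp add: scaleC_diff_right scaleC_scaleC scaleC_minus_left)
  ultimately show False using assms by (simp add: mem_spectrum)
qed

lemma compact_spectrum: "compact (spectrum (x::'a::unital_cstar_algebra))"
proof -
  have "open (- spectrum x)"
  proof (rule openI)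
    fix c assume "c \<in> - spectrum x"
    then obtain y where y: "(x - c *\<^sub>C 1) * y = 1" "y * (x - c *\<^sub>C 1) = 1"
      by (auto simp: mem_spectrum invertible_elem_def)
    define e where "e = 1 / (norm y + 1)"
    have e: "e > 0" "e * norm y < 1"
      by (simp_all add: e_def add_nonneg_pos divide_less_eq)
    have "ball c e \<subseteq> - spectrum x"
    proof
      fix d assume "d \<in> ball c e"
      then have "cmod (d - c) < e" by (simp add: dist_norm norm_minus_commute)
      then have "cmod (d - c) * norm y \<le> e * norm y" by (intro mult_right_mono) auto
      then have "norm ((d - c) *\<^sub>C y) < 1" using e by (simp add: norm_scaleC)
      then have "invertible_elem (1 - (d - c) *\<^sub>C y)" by (rule invertible_elem_one_minus)
      moreover have "invertible_elem (x - c *\<^sub>C 1)" using y by (rule invertible_elemI)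
      ultimately have "invertible_elem ((x - c *\<^sub>C 1) * (1 - (d - c) *\<^sub>C y))"
        by (intro invertible_elem_mult)
      moreover have "(x - c *\<^sub>C 1) * (1 - (d - c) *\<^sub>C y) = x - d *\<^sub>C 1"
        using y by (simp add: right_diff_distrib mult_scaleC_right scaleC_diff_left)
      ultimately show "d \<in> - spectrum x" by (simp add: mem_spectrum)
    qed
    then show "\<exists>e>0. ball c e \<subseteq> - spectrum x" using e by blast
  qed
  moreover have "bounded (spectrum x)"
    by (rule boundedI[where B = "norm x"]) (simp add: spectrum_norm_le)
  ultimately show ?thesis by (simp add: compact_eq_bounded_closed closed_def)
qed

lemma spectrum_add_scaleC_one:
  "c \<in> spectrum (x + d *\<^sub>C 1) \<longleftrightarrow> c - d \<in> spectrum (x::'a::unital_cstar_algebra)"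
  by (simp add: mem_spectrum scaleC_diff_left algebra_simps)

lemma spectrum_minus: "c \<in> spectrum (- x) \<longleftrightarrow> - c \<in> spectrum (x::'a::unital_cstar_algebra)"
  using invertible_elem_minus[of "x + c *\<^sub>C 1"]
  by (simp add: mem_spectrum scaleC_minus_left)

text \<open>If \<open>s + \<i>t\<close> is in the spectrum of \<open>x\<close>, then \<open>s + \<i>(t + u)\<close> is in that of \<open>x + \<i>u\<close> for every
  real \<open>u\<close>, and the \<open>C\<^sup>*\<close>-identity bounds the norm of the latter by \<open>\<surd>(\<parallel>x\<parallel>\<^sup>2 + u\<^sup>2)\<close>; for \<open>t \<noteq> 0\<close>
  a suitable \<open>u\<close> violates this bound.\<close>

lemma spectrum_selfadjoint_real:
  assumes "selfadjoint (x::'a::unital_cstar_algebra)" "c \<in> spectrum x"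
  shows "Im c = 0"
proof (rule ccontr)
  assume t: "Im c \<noteq> 0"
  define u where "u = ((norm x)\<^sup>2 + 1) / (2 * Im c)"
  define w where "w = \<i> * complex_of_real u"
  define y where "y = x + w *\<^sub>C 1"
  have "c + w \<in> spectrum y" using assms(2) by (simp add: y_def spectrum_add_scaleC_one)
  then have "(cmod (c + w))\<^sup>2 \<le> (norm y)\<^sup>2" by (intro power_mono spectrum_norm_le) auto
  also have "\<dots> = norm (star y * y)" by (simp add: cstar_identity)
  also have "star y * y = x * x + (u\<^sup>2) *\<^sub>R 1"
  proof -
    have w: "cnj w = - w" "w * w = - complex_of_real (u\<^sup>2)"
      by (simp_all add: w_def power2_eq_square complex_eq_iff)
    have "star y * y = x * x - (w * w) *\<^sub>C 1"
      using assms(1) by (simp add: y_def star_add star_scaleC selfadjoint_def w(1)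
        scaleC_minus_left scaleC_diff_right algebra_simps mult_scaleC_left mult_scaleC_right
        scaleC_scaleC)
    then show ?thesis unfolding w(2) scaleC_minus_left scaleC_of_real by simp
  qed
  also have "norm (x * x + (u\<^sup>2) *\<^sub>R (1::'a)) \<le> norm x * norm x + u\<^sup>2 * 1"
    by (rule order_trans[OF norm_triangle_ineq] add_mono norm_mult_ineq)+
       (simp add: mult_left_le norm_one_le)
  finally have "(Re c)\<^sup>2 + (Im c + u)\<^sup>2 \<le> (norm x)\<^sup>2 + u\<^sup>2"
    by (simp add: cmod_power2 w_def power2_eq_square[of "norm x"])
  then have "(Im c)\<^sup>2 + 2 * Im c * u \<le> (norm x)\<^sup>2"
    using zero_le_power2[of "Re c"] by (simp only: power2_sum)
  moreover have "2 * Im c * u = (norm x)\<^sup>2 + 1" using t by (simp add: u_def)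
  ultimately show False using zero_le_power2[of "Im c"] by linarith
qed

lemma spectrum_selfadjoint_of_real_Re:
  assumes "selfadjoint x" "c \<in> spectrum x"
  shows "complex_of_real (Re c) = c"
  using spectrum_selfadjoint_real[OF assms] by (simp add: complex_eq_iff)

section \<open>The spectral radius\<close>

text \<open>The two-sided inverse, an arbitrary element if there is none.\<close>

definition inverse_elem :: "'a::unital_cstar_algebra \<Rightarrow> 'a" where
  "inverse_elem x = (SOME y. x * y = 1 \<and> y * x = 1)"

lemma inverse_elem:
  assumes "invertible_elem x"
  shows "x * inverse_elem x = 1" "inverse_elem x * x = 1"
  using someI_ex[OF assms[unfolded invertible_elem_def]] by (auto simp: inverse_elem_def)

lemma inverse_elem_unique:
  assumes "x * y = 1" "y * x = 1"
  shows "inverse_elem x = y"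
proof -
  have "invertible_elem x" using assms by (rule invertible_elemI)
  from inverse_elem[OF this] show ?thesis by (metis assms(1) mult.assoc mult_1_left mult_1_right)
qed

text \<open>The resolvent identity.\<close>

lemma inverse_elem_diff:
  assumes "invertible_elem x" "invertible_elem y"
  shows "inverse_elem x - inverse_elem y = inverse_elem x * (y - x) * inverse_elem y"
proof -
  have "inverse_elem x * (y - x) * inverse_elem y
      = inverse_elem x * (y * inverse_elem y) - (inverse_elem x * x) * inverse_elem y"
    by (simp add: algebra_simps mult.assoc)
  then show ?thesis by (simp add: inverse_elem assms)
qed

lemma inverse_elem_one_minus_square:
  assumes "invertible_elem (1 - y)" "invertible_elem (1 + y)"
  shows "invertible_elem (1 - y * y)"
    and "inverse_elem (1 - y * y) = (1/2) *\<^sub>R (inverse_elem (1 - y) + inverse_elem (1 + y))"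
proof -
  let ?P = "inverse_elem (1 - y)" and ?Q = "inverse_elem (1 + y)"
  have f: "1 - y * y = (1 + y) * (1 - y)" "1 - y * y = (1 - y) * (1 + y)"
    by (simp_all add: algebra_simps)
  have one: "(1/2) *\<^sub>R ((1 + y) + (1 - y)) = 1" "(1/2) *\<^sub>R ((1 - y) + (1 + y)) = 1"
    by (simp_all add: scaleR_2[symmetric])
  have p: "(1 - y * y) * ?P = 1 + y" "(1 - y * y) * ?Q = 1 - y"
    by (simp only: f(1) mult.assoc inverse_elem[OF assms(1)] mult_1_right)
       (simp only: f(2) mult.assoc inverse_elem[OF assms(2)] mult_1_right)
  have q: "?P * (1 - y * y) = 1 + y" "?Q * (1 - y * y) = 1 - y"
    by (simp only: f(2) mult.assoc[symmetric] inverse_elem[OF assms(1)] mult_1_left)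
       (simp only: f(1) mult.assoc[symmetric] inverse_elem[OF assms(2)] mult_1_left)
  have "(1 - y * y) * ((1/2) *\<^sub>R (?P + ?Q)) = 1"
    by (simp only: mult_scaleR_right distrib_left p one)
  moreover have "((1/2) *\<^sub>R (?P + ?Q)) * (1 - y * y) = 1"
    by (simp only: mult_scaleR_left distrib_right q one)
  ultimately show "invertible_elem (1 - y * y)"
    "inverse_elem (1 - y * y) = (1/2) *\<^sub>R (?P + ?Q)"
    by (blast intro: invertible_elemI inverse_elem_unique)+
qed

lemma continuous_on_resolvent:
  assumes "\<And>z. z \<in> S \<Longrightarrow> invertible_elem (1 - z *\<^sub>C (x::'a::unital_cstar_algebra))"
  shows "continuous_on S (\<lambda>z. inverse_elem (1 - z *\<^sub>C x))"
proof (rule continuous_onI)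
  fix w and e :: real
  assume w: "w \<in> S" and e: "e > 0"
  define F where "F = (\<lambda>z. inverse_elem (1 - z *\<^sub>C x))"
  define K where "K = norm x * norm (F w)"
  define L where "L = K + 1"
  define N where "N = norm (F w) + 1"
  have N: "N > 0" by (simp add: N_def add_nonneg_pos)
  have K: "K \<ge> 0" by (simp add: K_def)
  then have L: "L > 0" "K \<le> L" by (simp_all add: L_def)
  have diff: "norm (F z - F w) \<le> norm (F z) * (cmod (z - w) * K)" if "z \<in> S" for z
  proof -
    have "F z - F w = F z * ((z - w) *\<^sub>C x) * F w"
      using inverse_elem_diff[OF assms[OF that] assms[OF w]]
      by (simp add: F_def scaleC_diff_left algebra_simps)
    also have "norm \<dots> \<le> norm (F z * ((z - w) *\<^sub>C x)) * norm (F w)" by (rule norm_mult_ineq)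
    also have "\<dots> \<le> (norm (F z) * norm ((z - w) *\<^sub>C x)) * norm (F w)"
      by (intro mult_right_mono norm_mult_ineq) simp
    finally show ?thesis by (simp add: norm_scaleC K_def mult.assoc)
  qed
  \<comment> \<open>The first bound keeps \<open>\<parallel>F z\<parallel> \<le> 2 \<parallel>F w\<parallel>\<close>; the second then makes \<open>\<parallel>F z - F w\<parallel> \<le> e\<close>.\<close>
  define d where "d = min (1 / (2 * L)) (e / (2 * N * L))"
  have "d > 0" using L N e by (simp add: d_def)
  moreover have "dist (F z) (F w) \<le> e" if z: "z \<in> S" "dist z w < d" for z
  proof -
    have zw: "cmod (z - w) * L \<le> d * L"
      using z L by (intro mult_right_mono) (auto simp: dist_norm)
    have "d * L \<le> 1 / (2 * L) * L"
      using L by (intro mult_right_mono) (auto simp: d_def)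
    then have d1: "d * L \<le> 1/2" using L by simp
    have "d * L \<le> e / (2 * N * L) * L"
      using L by (intro mult_right_mono) (auto simp: d_def)
    then have d2: "d * L \<le> e / (2 * N)" using L by simp
    have le: "cmod (z - w) * K \<le> d * L"
      by (rule order_trans[OF mult_left_mono zw]) (simp_all add: L)
    have "norm (F z) \<le> norm (F w) + norm (F z - F w)" using norm_triangle_sub by blast
    also have "\<dots> \<le> norm (F w) + norm (F z) * (1/2)"
      using diff[OF z(1)] le d1 by (smt (verit) mult_left_mono norm_ge_zero)
    finally have b: "norm (F z) \<le> 2 * norm (F w)" by simp
    have "norm (F z - F w) \<le> norm (F z) * (cmod (z - w) * K)" using diff[OF z(1)] .
    also have "\<dots> \<le> (2 * N) * (e / (2 * N))"
      using b le d2 K by (intro mult_mono) (auto simp: N_def)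
    also have "\<dots> = e" using N by simp
    finally show ?thesis by (simp add: dist_norm)
  qed
  ultimately show "\<exists>d>0. \<forall>z\<in>S. dist z w < d \<longrightarrow> dist (inverse_elem (1 - z *\<^sub>C x)) (inverse_elem (1 - w *\<^sub>C x)) \<le> e"
    unfolding F_def by blast
qed

lemma power_two_power_Suc: "(x::'a::monoid_mult) ^ (2 ^ Suc k) = x ^ (2 ^ k) * x ^ (2 ^ k)"
  by (simp add: mult_2 power_add)

lemma scaleC_mult_scaleC: "(c *\<^sub>C x) * (d *\<^sub>C y) = (c * d) *\<^sub>C (x * (y::'a::unital_cstar_algebra))"
  by (simp add: mult_scaleC_left mult_scaleC_right scaleC_scaleC mult.commute)

text \<open>If the spectrum of \<open>x\<close> misses the unit circle, the resolvent \<open>(1 - z x)\<^sup>-\<^sup>1\<close> is uniformly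
  continuous on the closed unit disc. Averaging over \<open>n\<close>-th roots of unity turns it into
  \<open>(1 - z\<^sup>n x\<^sup>n)\<^sup>-\<^sup>1\<close> without spoiling the modulus of continuity; it suffices to take \<open>n = 2\<^sup>k\<close>, where
  the average is built from the identity
  \<open>(1 - y\<^sup>2)\<^sup>-\<^sup>1 = ((1 - y)\<^sup>-\<^sup>1 + (1 + y)\<^sup>-\<^sup>1) / 2\<close>. Inside the disc these averages tend to \<open>1\<close>, so
  that those on the circle get close to \<open>1\<close>, which forces \<open>\<parallel>x\<^sup>n\<parallel> < 1\<close>.\<close>

lemma spectrum_meets_unit_circle:
  fixes x :: "'a::unital_cstar_algebra"
  assumes "\<And>k. norm (x ^ (2 ^ k)) = 1"
  shows "\<exists>c\<in>spectrum x. cmod c = 1"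
proof (rule ccontr)
  assume none: "\<not> ?thesis"
  have nx: "norm x = 1" using assms[of 0] by simp
  have inv1: "invertible_elem (1 - z *\<^sub>C x)" if z: "cmod z \<le> 1" for z
  proof (cases "z = 0")
    case False
    have "inverse z \<notin> spectrum x"
    proof
      assume *: "inverse z \<in> spectrum x"
      then have "1 / cmod z \<le> 1" using spectrum_norm_le nx by (force simp: norm_inverse inverse_eq_divide norm_divide)
      then have "cmod z = 1" using z False by (simp add: divide_le_eq)
      then show False using none * by (auto simp: norm_inverse)
    qed
    then have "invertible_elem ((-z) *\<^sub>C (x - inverse z *\<^sub>C 1))"
      using False by (subst invertible_elem_scaleC) (auto simp: mem_spectrum)
    then show ?thesis
      using False by (simp add: scaleC_diff_right scaleC_scaleC scaleC_minus_left)
  qed simp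
  have "continuous_on (cball 0 1) (\<lambda>z. inverse_elem (1 - z *\<^sub>C x))"
    by (intro continuous_on_resolvent inv1) simp
  then have "uniformly_continuous_on (cball 0 1) (\<lambda>z. inverse_elem (1 - z *\<^sub>C x))"
    by (rule compact_uniformly_continuous) simp
  then obtain d where d: "d > 0" and unif: "\<And>z w. cmod z \<le> 1 \<Longrightarrow> cmod w \<le> 1 \<Longrightarrow> dist w z < d \<Longrightarrow>
      dist (inverse_elem (1 - w *\<^sub>C x)) (inverse_elem (1 - z *\<^sub>C x)) < 1/4"
    unfolding uniformly_continuous_on_def by (metis mem_cball_0 zero_less_divide_1_iff zero_less_numeral)
  \<comment> \<open>A radius \<open>s < 1\<close> so close to \<open>1\<close> that the resolvent varies by less than \<open>1/4\<close> between
    \<open>s u\<close> and \<open>u\<close> on the unit circle.\<close>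
  define s where "s = max 0 (1 - d/2)"
  have s: "0 \<le> s" "s < 1" "1 - s < d" using d by (auto simp: s_def)
  define n where "n k = (2::nat) ^ k" for k :: nat
  have step: "(\<forall>z. cmod z \<le> 1 \<longrightarrow> invertible_elem (1 - z *\<^sub>C x ^ n k)) \<and>
     (\<forall>u. cmod u = 1 \<longrightarrow> norm (inverse_elem (1 - u *\<^sub>C x ^ n k)
         - inverse_elem (1 - (complex_of_real (s ^ n k) * u) *\<^sub>C x ^ n k)) \<le> 1/4)" for k
  proof (induction k)
    case 0
    have "norm (inverse_elem (1 - u *\<^sub>C x) - inverse_elem (1 - (complex_of_real s * u) *\<^sub>C x)) \<le> 1/4"
      if u: "cmod u = 1" for u
    proof -
      have "u - complex_of_real s * u = complex_of_real (1 - s) * u" by (simp add: algebra_simps)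
      then have "cmod (u - complex_of_real s * u) = 1 - s"
        using u s by (metis abs_of_nonneg diff_ge_0_iff_ge less_imp_le mult_1_right norm_mult norm_of_real)
      then show ?thesis
        using unif[of "complex_of_real s * u" u] u s by (simp add: dist_norm norm_mult)
    qed
    then show ?case using inv1 by (simp add: n_def)
  next
    case (Suc k)
    let ?y = "x ^ n k"
    have sq: "(v * v) *\<^sub>C x ^ n (Suc k) = (v *\<^sub>C ?y) * (v *\<^sub>C ?y)" for v
      by (simp only: n_def power_two_power_Suc scaleC_mult_scaleC)
    have inv: "invertible_elem (1 - v *\<^sub>C ?y)" "invertible_elem (1 + v *\<^sub>C ?y)" if "cmod v \<le> 1" for v
    proof -
      show "invertible_elem (1 - v *\<^sub>C ?y)" using Suc that by blast
      have "invertible_elem (1 - (- v) *\<^sub>C ?y)" using Suc that norm_minus_cancel by metis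
      then show "invertible_elem (1 + v *\<^sub>C ?y)" by (simp add: scaleC_minus_left)
    qed
    have avg: "invertible_elem (1 - (v * v) *\<^sub>C x ^ n (Suc k))"
      "inverse_elem (1 - (v * v) *\<^sub>C x ^ n (Suc k))
        = (1/2) *\<^sub>R (inverse_elem (1 - v *\<^sub>C ?y) + inverse_elem (1 + v *\<^sub>C ?y))"
      if "cmod v \<le> 1" for v
      unfolding sq using inverse_elem_one_minus_square[OF inv[OF that]] by blast+
    have root: "\<exists>v. z = v * v \<and> cmod v \<le> 1 \<and> (cmod z = 1 \<longrightarrow> cmod v = 1)" if "cmod z \<le> 1" for z
    proof -
      have "z = csqrt z * csqrt z" by (metis power2_csqrt power2_eq_square)
      moreover have "cmod (csqrt z) = sqrt (cmod z)" by simp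
      ultimately show ?thesis using that by (metis real_sqrt_le_1_iff real_sqrt_one)
    qed
    have "norm (inverse_elem (1 - u *\<^sub>C x ^ n (Suc k))
         - inverse_elem (1 - (complex_of_real (s ^ n (Suc k)) * u) *\<^sub>C x ^ n (Suc k))) \<le> 1/4"
      if u: "cmod u = 1" for u
    proof -
      obtain v where v: "u = v * v" "cmod v = 1" using root[of u] u by auto
      define t where "t = complex_of_real (s ^ n k)"
      have t1: "cmod (t * v) \<le> 1" using v s by (simp add: t_def norm_mult norm_power power_le_one)
      have tu: "complex_of_real (s ^ n (Suc k)) * u = (t * v) * (t * v)"
        by (simp only: v(1) t_def n_def power_two_power_Suc of_real_mult mult_ac)
      let ?D = "\<lambda>v. inverse_elem (1 - v *\<^sub>C ?y) - inverse_elem (1 - (t * v) *\<^sub>C ?y)"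
      have Dw: "norm (?D w) \<le> 1/4" if "cmod w = 1" for w
        using Suc that unfolding t_def by blast
      have D: "norm (?D v) \<le> 1/4" "norm (?D (-v)) \<le> 1/4"
        by (rule Dw[OF v(2)], rule Dw[of "-v", unfolded norm_minus_cancel, OF v(2)])
      have "inverse_elem (1 - (v * v) *\<^sub>C x ^ n (Suc k)) -
          inverse_elem (1 - ((t * v) * (t * v)) *\<^sub>C x ^ n (Suc k)) = (1/2) *\<^sub>R (?D v + ?D (-v))"
        using v(2) by (simp add: avg(2) t1 scaleC_minus_left scaleR_add_right scaleR_diff_right)
      also have "norm \<dots> \<le> 1/2 * (1/4 + 1/4)"
        unfolding norm_scaleR using norm_triangle_mono[OF D] by simp
      finally show ?thesis by (simp add: tu flip: v(1) del: of_real_power)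
    qed
    then show ?case using root avg(1) by metis
  qed
  \<comment> \<open>For large \<open>k\<close> the average \<open>B\<close> on the inner circle is within \<open>1/7\<close> of \<open>1\<close>, hence \<open>A\<close> on the unit
    circle is within \<open>1/4 + 1/7 = 11/28\<close> of \<open>1\<close>.\<close>
  have "(\<lambda>k. s ^ n k) \<longlonglongrightarrow> 0"
  proof -
    have "strict_mono n" by (auto simp: n_def strict_mono_def)
    from LIMSEQ_subseq_LIMSEQ[OF LIMSEQ_realpow_zero[OF s(1,2)] this] show ?thesis by (simp add: o_def)
  qed
  then have "eventually (\<lambda>k. s ^ n k < 1/8) sequentially" by (rule order_tendstoD) simp
  then obtain k where k: "s ^ n k < 1/8" using eventually_happens by fastforce
  define y where "y = x ^ n k"
  define t where "t = complex_of_real (s ^ n k)"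
  define A where "A = inverse_elem (1 - y)"
  define B where "B = inverse_elem (1 - t *\<^sub>C y)"
  have ny: "norm y = 1" using assms by (simp add: y_def n_def)
  have ct: "cmod t < 1/8" using k s(1) by (simp add: t_def norm_power)
  have inv: "invertible_elem (1 - y)" "invertible_elem (1 - t *\<^sub>C y)"
    using step[of k, THEN conjunct1, rule_format, of 1] step[of k, THEN conjunct1, rule_format, of t] ct
    by (simp_all add: y_def)
  have AB: "norm (A - B) \<le> 1/4"
    using step[of k, THEN conjunct2, rule_format, of 1] by (simp add: A_def B_def y_def t_def)
  have B: "B - 1 = (t *\<^sub>C y) * B"
    using inverse_elem(1)[OF inv(2)] by (simp add: B_def algebra_simps)
  have "norm (B - 1) \<le> norm (t *\<^sub>C y) * norm B" unfolding B by (rule norm_mult_ineq)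
  also have "\<dots> \<le> 1/8 * norm B" using ct ny by (intro mult_right_mono) (auto simp: norm_scaleC)
  also have "norm B \<le> norm (B - 1) + 1"
    using norm_triangle_sub[of B 1] norm_one_le[where 'a = 'a] by linarith
  finally have "norm (B - 1) \<le> 1/7" by simp
  moreover have "norm (A - 1) \<le> norm (A - B) + norm (B - 1)"
    using norm_triangle_ineq[of "A - B" "B - 1"] by simp
  ultimately have "norm (A - 1) \<le> 11/28" using AB by simp
  moreover have "norm (1 - y) \<le> 2"
    using norm_triangle_ineq4[of 1 y] ny norm_one_le[where 'a = 'a] by linarith
  ultimately have "norm (A - 1) * norm (1 - y) \<le> 11/28 * 2" by (intro mult_mono) auto
  moreover have "y = (A - 1) * (1 - y)"
    using inverse_elem(2)[OF inv(1)] by (simp add: A_def algebra_simps)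
  ultimately have "norm y \<le> 11/28 * 2" by (metis norm_mult_ineq order_trans)
  then show False using ny by simp
qed

lemma norm_selfadjoint_two_power:
  assumes "selfadjoint (x::'a::unital_cstar_algebra)"
  shows "norm (x ^ (2 ^ k)) = norm x ^ (2 ^ k)"
proof (induction k)
  case (Suc k)
  have "norm (x ^ (2 ^ Suc k)) = norm (star (x ^ (2 ^ k)) * x ^ (2 ^ k))"
    using selfadjoint_power[OF assms, of "2 ^ k"] by (simp only: power_two_power_Suc selfadjoint_def)
  also have "\<dots> = norm x ^ (2 ^ Suc k)"
    by (simp only: cstar_identity Suc power2_eq_square power_two_power_Suc)
  finally show ?case .
qed simp

lemma selfadjoint_norm_attained:
  assumes "selfadjoint (x::'a::unital_cstar_algebra)" "x \<noteq> 0"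
  shows "\<exists>c\<in>spectrum x. cmod c = norm x"
proof -
  define r where "r = complex_of_real (norm x)"
  define y where "y = (1 / norm x) *\<^sub>R x"
  have "selfadjoint y" "norm y = 1" using assms by (simp_all add: y_def selfadjoint_scaleR)
  then obtain c where c: "c \<in> spectrum y" "cmod c = 1"
    using spectrum_meets_unit_circle[of y] norm_selfadjoint_two_power[of y] by auto
  have "r \<noteq> 0" using assms by (simp add: r_def)
  moreover have "x - (r * c) *\<^sub>C 1 = r *\<^sub>C (y - c *\<^sub>C 1)"
    using assms by (simp add: r_def y_def scaleC_diff_right scaleC_scaleC scaleC_of_real)
  ultimately have "r * c \<in> spectrum x"
    using c(1) by (simp add: mem_spectrum invertible_elem_scaleC)
  moreover have "cmod (r * c) = norm x" using c(2) by (simp add: norm_mult r_def)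
  ultimately show ?thesis by blast
qed

section \<open>Polynomials of an element\<close>

text \<open>The value of a complex polynomial at an element of the algebra, by Horner's scheme.\<close>

definition poly_elem :: "complex poly \<Rightarrow> 'a::unital_cstar_algebra \<Rightarrow> 'a" where
  "poly_elem p x = fold_coeffs (\<lambda>c y. c *\<^sub>C 1 + x * y) p 0"

lemma poly_elem_0 [simp]: "poly_elem 0 x = 0"
  by (simp add: poly_elem_def)

lemma poly_elem_pCons: "poly_elem (pCons c p) x = c *\<^sub>C 1 + x * poly_elem p x"
  by (cases "p = 0 \<and> c = 0") (auto simp: poly_elem_def)

lemma poly_elem_const: "poly_elem [:c:] x = c *\<^sub>C 1"
  and poly_elem_X [simp]: "poly_elem [:0, 1:] x = x"
  by (simp_all add: poly_elem_pCons)

lemma poly_elem_add: "poly_elem (p + q) x = poly_elem p x + poly_elem q x"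
  by (induction p q rule: poly_induct2) (simp_all add: poly_elem_pCons scaleC_add_left algebra_simps)

lemma poly_elem_smult: "poly_elem (smult c p) x = c *\<^sub>C poly_elem p x"
  by (induction p) (simp_all add: poly_elem_pCons scaleC_add_right scaleC_scaleC mult_scaleC_right)

lemma poly_elem_diff: "poly_elem (p - q) x = poly_elem p x - poly_elem q x"
  using poly_elem_add[of p "- q" x] poly_elem_smult[of "-1" q x] by (simp add: scaleC_minus_left)

lemma poly_elem_commute:
  assumes "y * x = x * y"
  shows "y * poly_elem p x = poly_elem p x * y"
proof (induction p)
  case (pCons c p)
  have "y * (x * poly_elem p x) = x * poly_elem p x * y"
    by (metis assms mult.assoc pCons.IH)
  then show ?case by (simp add: poly_elem_pCons algebra_simps mult_scaleC_left mult_scaleC_right)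
qed simp

lemma poly_elem_mult: "poly_elem (p * q) x = poly_elem p x * poly_elem q x"
  by (induction p)
     (simp_all add: poly_elem_pCons poly_elem_add poly_elem_smult mult_scaleC_left algebra_simps mult.assoc)

lemma poly_elem_star: "star (poly_elem p x) = poly_elem (map_poly cnj p) (star x)"
proof (induction p)
  case (pCons c p)
  have "star x * poly_elem (map_poly cnj p) (star x) = poly_elem (map_poly cnj p) (star x) * star x"
    by (rule poly_elem_commute) simp
  then show ?case
    by (simp add: poly_elem_pCons map_poly_pCons star_add star_mult star_scaleC pCons.IH)
qed simp

lemma spectrum_selfadjoint_nonempty:
  assumes "selfadjoint (x::'a::unital_cstar_algebra)" "\<not> invertible_elem (0::'a)"
  shows "spectrum x \<noteq> {}"
proof (cases "x = 0")
  case True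
  then have "0 \<in> spectrum x" using assms(2) by (simp add: mem_spectrum)
  then show ?thesis by blast
qed (use selfadjoint_norm_attained[OF assms(1)] in blast)

text \<open>One half of the spectral mapping theorem: if \<open>p - d \<noteq> 0\<close> has no root in the spectrum of \<open>x\<close>,
  then
  \<open>p(x) - d\<close> is a product of invertible linear factors. Self-adjointness only serves the
  case of constant \<open>p\<close>, where the spectrum of \<open>x\<close> has to be nonempty.\<close>

lemma spectrum_poly_elem:
  assumes sa: "selfadjoint (x::'a::unital_cstar_algebra)"
  shows "spectrum (poly_elem p x) \<subseteq> poly p ` spectrum x"
proof
  fix d assume d: "d \<in> spectrum (poly_elem p x)"
  have *: "\<exists>c\<in>spectrum x. poly q c = 0" if "\<not> invertible_elem (poly_elem q x)" for q
    using that
  proof (induction "degree q" arbitrary: q rule: less_induct)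
    case less
    consider (zero) "q = 0" | (const) a where "a \<noteq> 0" "q = [:a:]"
      | (root) z where "q \<noteq> 0" "poly q z = 0"
      using fundamental_theorem_of_algebra_alt[of q] by fastforce
    then show ?case
    proof cases
      case zero
      then show ?thesis using less.prems spectrum_selfadjoint_nonempty[OF sa] by auto
    next
      case const
      then show ?thesis
        using less.prems invertible_elem_scaleC[of _ "1::'a"] by (auto simp: poly_elem_const)
    next
      case root
      then obtain r where r: "q = [:- z, 1:] * r" by (auto simp: poly_eq_0_iff_dvd)
      have lin: "poly_elem [:- z, 1:] x = x - z *\<^sub>C 1"
        by (simp add: poly_elem_pCons scaleC_minus_left)
      show ?thesis
      proof (cases "z \<in> spectrum x")
        case False
        then have "\<not> invertible_elem (poly_elem r x)"
          using less.prems invertible_elem_mult unfolding r poly_elem_mult lin mem_spectrum by blast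
        moreover have "degree r < degree q"
          using root(1) by (simp add: r degree_mult_eq del: mult_pCons_left)
        ultimately obtain c where "c \<in> spectrum x" "poly r c = 0" using less.hyps by blast
        then show ?thesis unfolding r poly_mult by force
      qed (use root(2) in blast)
    qed
  qed
  have "\<not> invertible_elem (poly_elem (p - [:d:]) x)"
    using d by (simp add: mem_spectrum poly_elem_diff poly_elem_const)
  from *[OF this] show "d \<in> poly p ` spectrum x" by auto
qed

text \<open>The other half: \<open>p - p(c)\<close> is divisible by \<open>X - c\<close>.\<close>

lemma poly_mem_spectrum:
  assumes "c \<in> spectrum (x::'a::unital_cstar_algebra)"
  shows "poly p c \<in> spectrum (poly_elem p x)"
proof -
  have "poly (p - [:poly p c:]) c = 0" by simp
  then obtain q where q: "p - [:poly p c:] = [:- c, 1:] * q" unfolding poly_eq_0_iff_dvd by blast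
  have "poly_elem p x - poly p c *\<^sub>C 1 = poly_elem (p - [:poly p c:]) x"
    by (simp add: poly_elem_diff poly_elem_const)
  also have "\<dots> = (x - c *\<^sub>C 1) * poly_elem q x"
    unfolding q poly_elem_mult by (simp add: poly_elem_pCons scaleC_minus_left)
  finally have eq: "poly_elem p x - poly p c *\<^sub>C 1 = (x - c *\<^sub>C 1) * poly_elem q x" .
  have "(x - c *\<^sub>C 1) * poly_elem q x = poly_elem q x * (x - c *\<^sub>C 1)"
    by (rule poly_elem_commute) (simp add: algebra_simps mult_scaleC_left mult_scaleC_right)
  from invertible_elem_mult_commuting[OF this] assms show ?thesis by (simp add: mem_spectrum eq)
qed

text \<open>By the \<open>C\<^sup>*\<close>-identity the bound for \<open>p(x)\<close> reduces to the self-adjoint element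
  \<open>p(x)\<^sup>* p(x)\<close>, whose norm is attained on its spectrum.\<close>

lemma norm_poly_elem_le_iff:
  assumes sa: "selfadjoint (x::'a::unital_cstar_algebra)" and M: "0 \<le> M"
  shows "norm (poly_elem p x) \<le> M \<longleftrightarrow> (\<forall>z\<in>spectrum x. cmod (poly p z) \<le> M)"
proof
  assume le: "norm (poly_elem p x) \<le> M"
  have "cmod (poly p z) \<le> M" if "z \<in> spectrum x" for z
    using spectrum_norm_le[OF poly_mem_spectrum[OF that, of p]] le by linarith
  then show "\<forall>z\<in>spectrum x. cmod (poly p z) \<le> M" by blast
next
  assume bound: "\<forall>z\<in>spectrum x. cmod (poly p z) \<le> M"
  define q where "q = map_poly cnj p * p"
  have q: "poly_elem q x = star (poly_elem p x) * poly_elem p x"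
    using sa by (simp add: q_def poly_elem_mult poly_elem_star selfadjoint_def)
  then have nq: "norm (poly_elem q x) = (norm (poly_elem p x))\<^sup>2" by (simp add: cstar_identity)
  show "norm (poly_elem p x) \<le> M"
  proof (cases "poly_elem q x = 0")
    case False
    moreover have "selfadjoint (poly_elem q x)" by (simp add: q selfadjoint_def star_mult star_star)
    ultimately obtain d where d: "d \<in> spectrum (poly_elem q x)" "cmod d = norm (poly_elem q x)"
      using selfadjoint_norm_attained by blast
    then obtain c where c: "c \<in> spectrum x" "d = poly q c" using spectrum_poly_elem[OF sa] by blast
    have "cnj c = c" using spectrum_selfadjoint_real[OF sa c(1)] by (simp add: complex_eq_iff)
    then have "poly (map_poly cnj p) c = cnj (poly p c)" by (metis poly_cnj)
    then have "d = cnj (poly p c) * poly p c" unfolding c(2) q_def poly_mult by simp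
    then have "(norm (poly_elem p x))\<^sup>2 = (cmod (poly p c))\<^sup>2"
      using d(2) nq by (simp add: norm_mult power2_eq_square)
    also have "\<dots> \<le> M\<^sup>2" using bound c(1) by (intro power_mono) auto
    finally show ?thesis using M by (rule power2_le_imp_le)
  qed (use nq M in simp)
qed

section \<open>The continuous functional calculus\<close>

text \<open>On the spectrum of a self-adjoint element, a compact set of reals, the Weierstrass theorem
  applies to the real and the imaginary part.\<close>

lemma polynomials_dense_spectrum:
  assumes sa: "selfadjoint (x::'a::unital_cstar_algebra)" and g: "continuous_on (spectrum x) g"
  shows "\<exists>P. uniform_limit (spectrum x) (\<lambda>n. poly (P n)) g sequentially"
proof -
  define S where "S = Re ` spectrum x"
  have S: "compact S"
    unfolding S_def by (intro compact_continuous_image continuous_intros compact_spectrum)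
  have real: "complex_of_real (Re z) = z" if "z \<in> spectrum x" for z
    using spectrum_selfadjoint_of_real_Re[OF sa that] .
  have "continuous_on S (\<lambda>t. g (complex_of_real t))"
    by (rule continuous_on_compose2[OF g]) (auto simp: S_def real intro: continuous_intros)
  then have cont: "continuous_on S (\<lambda>t. Re (g (complex_of_real t)))"
    "continuous_on S (\<lambda>t. Im (g (complex_of_real t)))"
    by (auto intro: continuous_intros)
  have approx: "\<exists>p. \<forall>t\<in>S. cmod (complex_of_real (h t) - poly p (complex_of_real t)) < e"
    if h: "continuous_on S h" and e: "e > 0" for h e
  proof -
    obtain q where q: "real_polynomial_function q" "\<And>t. t \<in> S \<Longrightarrow> \<bar>h t - q t\<bar> < e"
      using Stone_Weierstrass_real_polynomial_function[OF S h e] by blast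
    then obtain c n where c: "q = (\<lambda>t. \<Sum>i\<le>n. c i * t ^ i)"
      by (auto simp: real_polynomial_function_iff_sum)
    define p where "p = (\<Sum>i\<le>n. monom (complex_of_real (c i)) i)"
    have "poly p (complex_of_real t) = complex_of_real (q t)" for t
      by (simp add: p_def c poly_sum poly_monom)
    then have "cmod (complex_of_real (h t) - poly p (complex_of_real t)) = \<bar>h t - q t\<bar>" for t
      by (metis norm_of_real of_real_diff)
    then show ?thesis using q(2) by (intro exI[of _ p]) simp
  qed
  have "\<exists>p. \<forall>z\<in>spectrum x. dist (poly p z) (g z) < inverse (Suc n)" for n
  proof -
    define e where "e = inverse (real (Suc n)) / 2"
    have e: "e > 0" by (simp add: e_def)
    obtain p q where p: "\<And>t. t \<in> S \<Longrightarrow> cmod (complex_of_real (Re (g t)) - poly p (complex_of_real t)) < e"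
      and q: "\<And>t. t \<in> S \<Longrightarrow> cmod (complex_of_real (Im (g t)) - poly q (complex_of_real t)) < e"
      using approx[OF cont(1) e] approx[OF cont(2) e] by blast
    have "dist (poly (p + smult \<i> q) z) (g z) < inverse (Suc n)" if z: "z \<in> spectrum x" for z
    proof -
      have t: "Re z \<in> S" using z by (simp add: S_def)
      have "g z - poly (p + smult \<i> q) z
          = (complex_of_real (Re (g z)) - poly p z) + \<i> * (complex_of_real (Im (g z)) - poly q z)"
        using complex_eq[of "g z"] by (simp add: algebra_simps)
      also have "cmod \<dots> \<le> cmod (complex_of_real (Re (g z)) - poly p z)
          + cmod (\<i> * (complex_of_real (Im (g z)) - poly q z))" by (rule norm_triangle_ineq)
      also have "\<dots> < e + e"
        using p[OF t] q[OF t] real[OF z] by (simp add: norm_mult)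
      finally show ?thesis by (simp add: e_def dist_norm norm_minus_commute)
    qed
    then show ?thesis by blast
  qed
  then obtain P where P: "\<And>n z. z \<in> spectrum x \<Longrightarrow> dist (poly (P n) z) (g z) < inverse (Suc n)"
    by metis
  have "uniform_limit (spectrum x) (\<lambda>n. poly (P n)) g sequentially"
  proof (rule uniform_limitI)
    fix e :: real assume "e > 0"
    then obtain N where N: "inverse (real (Suc N)) < e" using reals_Archimedean by blast
    have "dist (poly (P n) z) (g z) < e" if "n \<ge> N" "z \<in> spectrum x" for n z
    proof -
      have "inverse (real (Suc n)) \<le> inverse (real (Suc N))" using that(1) by simp
      then show ?thesis using P[OF that(2), of n] N by linarith
    qed
    then show "\<forall>\<^sub>F n in sequentially. \<forall>z\<in>spectrum x. dist (poly (P n) z) (g z) < e"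
      by (auto simp: eventually_sequentially)
  qed
  then show ?thesis by blast
qed

text \<open>\<open>calculus_value x g y\<close>: the element \<open>y\<close> is the limit of \<open>p\<^sub>n(x)\<close> for some polynomials \<open>p\<^sub>n\<close>
  that converge to \<open>g\<close> uniformly on the spectrum of \<open>x\<close>. For self-adjoint \<open>x\<close> this
  determines \<open>y\<close>, and for continuous \<open>g\<close> it amounts to \<open>y = g(x)\<close>.\<close>

definition calculus_value ::
  "'a::unital_cstar_algebra \<Rightarrow> (complex \<Rightarrow> complex) \<Rightarrow> 'a \<Rightarrow> bool" where
  "calculus_value x g y \<longleftrightarrow> (\<exists>P. uniform_limit (spectrum x) (\<lambda>n. poly (P n)) g sequentially \<and>
      (\<lambda>n. poly_elem (P n) x) \<longlonglongrightarrow> y)"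

lemma norm_poly_elem_uniform_limit:
  assumes sa: "selfadjoint (x::'a::unital_cstar_algebra)"
    and P: "uniform_limit (spectrum x) (\<lambda>n. poly (P n)) g sequentially"
    and M: "\<forall>z\<in>spectrum x. cmod (g z) \<le> M" "0 \<le> M" and e: "e > 0"
  shows "\<forall>\<^sub>F n in sequentially. norm (poly_elem (P n) x) \<le> M + e"
  using uniform_limitD[OF P e]
proof eventually_elim
  case (elim n)
  have "cmod (poly (P n) z) \<le> M + e" if "z \<in> spectrum x" for z
    using elim M that norm_triangle_sub[of "poly (P n) z" "g z"] by (force simp: dist_norm)
  then show ?case using norm_poly_elem_le_iff[OF sa, of "M + e" "P n"] M e by simp
qed

lemma calculus_value_norm_le_iff:
  assumes sa: "selfadjoint (x::'a::unital_cstar_algebra)"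
    and y: "calculus_value x g y" and M: "0 \<le> M"
  shows "norm y \<le> M \<longleftrightarrow> (\<forall>z\<in>spectrum x. cmod (g z) \<le> M)"
proof -
  obtain P where P: "uniform_limit (spectrum x) (\<lambda>n. poly (P n)) g sequentially"
    and lim: "(\<lambda>n. poly_elem (P n) x) \<longlonglongrightarrow> y"
    using y unfolding calculus_value_def by blast
  show ?thesis
  proof
    assume le: "norm y \<le> M"
    show "\<forall>z\<in>spectrum x. cmod (g z) \<le> M"
    proof
      fix z assume z: "z \<in> spectrum x"
      have "(\<lambda>n. cmod (poly (P n) z)) \<longlonglongrightarrow> cmod (g z)"
        using tendsto_uniform_limitI[OF P z] by (rule tendsto_norm)
      moreover have "(\<lambda>n. norm (poly_elem (P n) x)) \<longlonglongrightarrow> norm y" using lim by (rule tendsto_norm)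
      moreover have "cmod (poly (P n) z) \<le> norm (poly_elem (P n) x)" for n
        using spectrum_norm_le[OF poly_mem_spectrum[OF z]] .
      ultimately have "cmod (g z) \<le> norm y" by (intro LIMSEQ_le) auto
      then show "cmod (g z) \<le> M" using le by simp
    qed
  next
    assume bound: "\<forall>z\<in>spectrum x. cmod (g z) \<le> M"
    show "norm y \<le> M"
    proof (rule field_le_epsilon)
      fix e :: real assume "e > 0"
      from norm_poly_elem_uniform_limit[OF sa P bound M this]
      show "norm y \<le> M + e"
        using tendsto_upperbound[OF tendsto_norm[OF lim]] by force
    qed
  qed
qed

lemma calculus_value_exists:
  assumes sa: "selfadjoint (x::'a::unital_cstar_algebra)" and g: "continuous_on (spectrum x) g"
  shows "\<exists>y. calculus_value x g y"
proof -
  obtain P where P: "uniform_limit (spectrum x) (\<lambda>n. poly (P n)) g sequentially"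
    using polynomials_dense_spectrum[OF assms] by blast
  have "Cauchy (\<lambda>n. poly_elem (P n) x)"
  proof (rule CauchyI)
    fix e :: real assume e: "e > 0"
    then obtain N where N: "\<And>n z. n \<ge> N \<Longrightarrow> z \<in> spectrum x \<Longrightarrow> dist (poly (P n) z) (g z) < e / 4"
      using uniform_limitD[OF P, of "e / 4"] by (auto simp: eventually_sequentially)
    have "norm (poly_elem (P m) x - poly_elem (P n) x) < e" if "m \<ge> N" "n \<ge> N" for m n
    proof -
      have "cmod (poly (P m - P n) z) \<le> e / 2" if "z \<in> spectrum x" for z
      proof -
        have "dist (poly (P m) z) (poly (P n) z) \<le> e / 2"
          using N[OF \<open>m \<ge> N\<close> that] N[OF \<open>n \<ge> N\<close> that] dist_triangle2[of "poly (P m) z" "poly (P n) z" "g z"]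
          by linarith
        then show ?thesis by (simp add: dist_norm)
      qed
      then have "norm (poly_elem (P m - P n) x) \<le> e / 2"
        using e by (intro norm_poly_elem_le_iff[OF sa, THEN iffD2] ballI) simp_all
      then show ?thesis using e by (simp add: poly_elem_diff)
    qed
    then show "\<exists>N. \<forall>m\<ge>N. \<forall>n\<ge>N. norm (poly_elem (P m) x - poly_elem (P n) x) < e" by blast
  qed
  then obtain y where "(\<lambda>n. poly_elem (P n) x) \<longlonglongrightarrow> y"
    using Cauchy_convergent convergentD by blast
  with P show ?thesis unfolding calculus_value_def by blast
qed

lemma calculus_value_poly: "calculus_value x (poly p) (poly_elem p x)"
  unfolding calculus_value_def by (rule exI[of _ "\<lambda>_. p"]) (simp add: uniform_limit_const)

lemma calculus_value_add:
  assumes "calculus_value x g y" "calculus_value x h z"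
  shows "calculus_value x (\<lambda>w. g w + h w) (y + z)"
proof -
  obtain P Q where P: "uniform_limit (spectrum x) (\<lambda>n. poly (P n)) g sequentially"
    "(\<lambda>n. poly_elem (P n) x) \<longlonglongrightarrow> y"
    and Q: "uniform_limit (spectrum x) (\<lambda>n. poly (Q n)) h sequentially"
    "(\<lambda>n. poly_elem (Q n) x) \<longlonglongrightarrow> z"
    using assms unfolding calculus_value_def by blast
  show ?thesis unfolding calculus_value_def
    by (rule exI[of _ "\<lambda>n. P n + Q n"])
       (use uniform_limit_add[OF P(1) Q(1)] tendsto_add[OF P(2) Q(2)] in \<open>simp add: poly_elem_add poly_add[abs_def]\<close>)
qed

lemma calculus_value_scaleC:
  assumes "calculus_value x g y"
  shows "calculus_value x (\<lambda>w. c * g w) (c *\<^sub>C y)"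
proof -
  obtain P where P: "uniform_limit (spectrum x) (\<lambda>n. poly (P n)) g sequentially"
    "(\<lambda>n. poly_elem (P n) x) \<longlonglongrightarrow> y"
    using assms unfolding calculus_value_def by blast
  show ?thesis unfolding calculus_value_def
    by (rule exI[of _ "\<lambda>n. smult c (P n)"])
       (use bounded_linear.uniform_limit[OF bounded_linear_mult_right P(1), of c]
          bounded_linear.tendsto[OF bounded_linear_scaleC P(2), of c]
        in \<open>simp add: poly_elem_smult poly_smult[abs_def]\<close>)
qed

lemma calculus_value_mult:
  assumes "calculus_value x g y" "calculus_value x h z"
    and "continuous_on (spectrum x) g" "continuous_on (spectrum x) h"
  shows "calculus_value x (\<lambda>w. g w * h w) (y * z)"
proof -
  obtain P Q where P: "uniform_limit (spectrum x) (\<lambda>n. poly (P n)) g sequentially"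
    "(\<lambda>n. poly_elem (P n) x) \<longlonglongrightarrow> y"
    and Q: "uniform_limit (spectrum x) (\<lambda>n. poly (Q n)) h sequentially"
    "(\<lambda>n. poly_elem (Q n) x) \<longlonglongrightarrow> z"
    using assms unfolding calculus_value_def by blast
  have "bounded (g ` spectrum x)" "bounded (h ` spectrum x)"
    using assms by (auto intro!: compact_imp_bounded compact_continuous_image compact_spectrum)
  then show ?thesis unfolding calculus_value_def
    by (intro exI[of _ "\<lambda>n. P n * Q n"])
       (use uniform_lim_mult[OF P(1) Q(1)] tendsto_mult[OF P(2) Q(2)] in \<open>simp add: poly_elem_mult poly_mult[abs_def]\<close>)
qed

lemma calculus_value_star:
  assumes sa: "selfadjoint x" and "calculus_value x g y"
  shows "calculus_value x (\<lambda>w. cnj (g w)) (star y)"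
proof -
  obtain P where P: "uniform_limit (spectrum x) (\<lambda>n. poly (P n)) g sequentially"
    "(\<lambda>n. poly_elem (P n) x) \<longlonglongrightarrow> y"
    using assms unfolding calculus_value_def by blast
  have cnj: "poly (map_poly cnj p) z = cnj (poly p z)" if "z \<in> spectrum x" for p z
  proof -
    have "cnj z = z" using spectrum_selfadjoint_real[OF sa that] by (simp add: complex_eq_iff)
    then show ?thesis by (metis poly_cnj)
  qed
  have "uniform_limit (spectrum x) (\<lambda>n w. cnj (poly (P n) w)) (\<lambda>w. cnj (g w)) sequentially"
    by (rule bounded_linear.uniform_limit[OF bounded_linear_cnj P(1)])
  then have "uniform_limit (spectrum x) (\<lambda>n. poly (map_poly cnj (P n))) (\<lambda>w. cnj (g w)) sequentially"
    by (rule uniform_limit_cong'[THEN iffD1, rotated 2]) (simp_all only: cnj)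
  moreover have "(\<lambda>n. poly_elem (map_poly cnj (P n)) x) \<longlonglongrightarrow> star y"
    using bounded_linear.tendsto[OF bounded_linear_star P(2)] sa
    by (simp add: poly_elem_star selfadjoint_def)
  ultimately show ?thesis
    unfolding calculus_value_def by (intro exI[of _ "\<lambda>n. map_poly cnj (P n)"]) simp
qed

lemma calculus_value_unique:
  assumes sa: "selfadjoint x" and "calculus_value x g y" "calculus_value x g z"
  shows "y = z"
proof -
  have "calculus_value x (\<lambda>w. g w + (-1) * g w) (y + (-1) *\<^sub>C z)"
    using assms by (intro calculus_value_add calculus_value_scaleC)
  from calculus_value_norm_le_iff[OF sa this, of 0] show ?thesis by (simp add: scaleC_minus_left)
qed

lemma calculus_value_commute:
  assumes "calculus_value x g y" "u * x = x * u"
  shows "u * y = y * u"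
proof -
  obtain P where P: "(\<lambda>n. poly_elem (P n) x) \<longlonglongrightarrow> y"
    using assms(1) unfolding calculus_value_def by blast
  have "(\<lambda>n. u * poly_elem (P n) x) \<longlonglongrightarrow> u * y" by (intro tendsto_mult tendsto_const P)
  moreover have "(\<lambda>n. u * poly_elem (P n) x) \<longlonglongrightarrow> y * u"
    unfolding poly_elem_commute[OF assms(2)] by (intro tendsto_mult tendsto_const P)
  ultimately show ?thesis by (rule LIMSEQ_unique)
qed

lemma functional_calculusD:
  assumes "is_functional_calculus x \<Phi>" and "continuous_on (spectrum x) g"
  shows "continuous_on (spectrum x) h \<Longrightarrow> \<Phi> (\<lambda>z. g z + h z) = \<Phi> g + \<Phi> h"
    and "continuous_on (spectrum x) h \<Longrightarrow> \<Phi> (\<lambda>z. g z * h z) = \<Phi> g * \<Phi> h"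
    and "\<Phi> (\<lambda>z. c * g z) = c *\<^sub>C \<Phi> g"
    and "0 \<le> M \<Longrightarrow> norm (\<Phi> g) \<le> M \<longleftrightarrow> (\<forall>z\<in>spectrum x. cmod (g z) \<le> M)"
proof -
  note D = assms(1)[unfolded is_functional_calculus_def]
  show "continuous_on (spectrum x) h \<Longrightarrow> \<Phi> (\<lambda>z. g z + h z) = \<Phi> g + \<Phi> h"
    and "continuous_on (spectrum x) h \<Longrightarrow> \<Phi> (\<lambda>z. g z * h z) = \<Phi> g * \<Phi> h"
    using D[THEN conjunct1, rule_format, OF assms(2)] by blast+
  show "\<Phi> (\<lambda>z. c * g z) = c *\<^sub>C \<Phi> g"
    by (rule D[THEN conjunct2, THEN conjunct1, rule_format, OF assms(2)])
  show "0 \<le> M \<Longrightarrow> norm (\<Phi> g) \<le> M \<longleftrightarrow> (\<forall>z\<in>spectrum x. cmod (g z) \<le> M)"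
    by (rule D[THEN conjunct2, THEN conjunct2, THEN conjunct2, THEN conjunct1, rule_format, OF assms(2)])
qed

lemma functional_calculus_one_id:
  assumes "is_functional_calculus x \<Phi>"
  shows "\<Phi> (\<lambda>z. 1) = 1" and "\<Phi> (\<lambda>z. z) = x"
  using assms unfolding is_functional_calculus_def by simp_all

lemma functional_calculus_poly:
  assumes "is_functional_calculus x \<Phi>"
  shows "\<Phi> (poly p) = poly_elem p x"
proof (induction p)
  case 0
  have "\<Phi> (\<lambda>z. 0 * 1) = 0 *\<^sub>C \<Phi> (\<lambda>z. 1)"
    by (rule functional_calculusD[OF assms continuous_on_const])
  moreover have "poly 0 = (\<lambda>z. 0 * 1 :: complex)" by auto
  ultimately show ?case by simp
next
  case (pCons c p)
  have cont: "continuous_on (spectrum x) (poly p)" "continuous_on (spectrum x) (\<lambda>z. z)"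
    by (auto intro: continuous_intros)
  have "\<Phi> (\<lambda>z. c * 1) = c *\<^sub>C \<Phi> (\<lambda>z. 1)"
    by (rule functional_calculusD[OF assms continuous_on_const])
  then have "\<Phi> (\<lambda>z. c) = c *\<^sub>C 1" by (simp add: functional_calculus_one_id[OF assms])
  moreover have "\<Phi> (\<lambda>z. z * poly p z) = x * poly_elem p x"
    using functional_calculusD(2)[OF assms cont(2,1)]
    by (simp only: functional_calculus_one_id(2)[OF assms] pCons.IH)
  moreover have "\<Phi> (\<lambda>z. c + z * poly p z) = \<Phi> (\<lambda>z. c) + \<Phi> (\<lambda>z. z * poly p z)"
    by (rule functional_calculusD(1)[OF assms continuous_on_const continuous_on_mult[OF cont(2,1)]])
  moreover have "poly (pCons c p) = (\<lambda>z. c + z * poly p z)" by auto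
  ultimately show ?case by (simp add: poly_elem_pCons)
qed

text \<open>Uniqueness of the calculus: it is given by \<open>poly_elem\<close> on polynomials and is isometric.\<close>

lemma functional_calculus_value:
  assumes sa: "selfadjoint x" and \<Phi>: "is_functional_calculus x \<Phi>"
    and g: "continuous_on (spectrum x) g"
  shows "calculus_value x g (\<Phi> g)"
proof -
  obtain P where P: "uniform_limit (spectrum x) (\<lambda>n. poly (P n)) g sequentially"
    using polynomials_dense_spectrum[OF sa g] by blast
  have "(\<lambda>n. poly_elem (P n) x) \<longlonglongrightarrow> \<Phi> g"
  proof (rule LIMSEQ_I)
    fix e :: real assume e: "e > 0"
    then obtain N where N: "\<And>n z. n \<ge> N \<Longrightarrow> z \<in> spectrum x \<Longrightarrow> dist (poly (P n) z) (g z) < e / 2"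
      using uniform_limitD[OF P, of "e / 2"] by (auto simp: eventually_sequentially)
    have "norm (poly_elem (P n) x - \<Phi> g) < e" if n: "n \<ge> N" for n
    proof -
      have cont: "continuous_on (spectrum x) (poly (P n))" "continuous_on (spectrum x) (\<lambda>z. (-1) * g z)"
        "continuous_on (spectrum x) (\<lambda>z. poly (P n) z + (-1) * g z)"
        using g by (auto intro!: continuous_intros)
      have "\<Phi> (\<lambda>z. poly (P n) z + (-1) * g z) = \<Phi> (poly (P n)) + \<Phi> (\<lambda>z. (-1) * g z)"
        by (rule functional_calculusD(1)[OF \<Phi> cont(1,2)])
      also have "\<Phi> (\<lambda>z. (-1) * g z) = (-1) *\<^sub>C \<Phi> g"
        by (rule functional_calculusD(3)[OF \<Phi> g])
      finally have eq: "\<Phi> (\<lambda>z. poly (P n) z + (-1) * g z) = poly_elem (P n) x - \<Phi> g"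
        by (simp add: functional_calculus_poly[OF \<Phi>] scaleC_minus_left)
      have "\<forall>z\<in>spectrum x. cmod (poly (P n) z + (-1) * g z) \<le> e / 2"
        using N[OF n] by (force simp: dist_norm)
      then have "norm (\<Phi> (\<lambda>z. poly (P n) z + (-1) * g z)) \<le> e / 2"
        using functional_calculusD(4)[OF \<Phi> cont(3), of "e / 2"] e by simp
      then show ?thesis using e unfolding eq by simp
    qed
    then show "\<exists>N. \<forall>n\<ge>N. norm (poly_elem (P n) x - \<Phi> g) < e" by blast
  qed
  with P show ?thesis unfolding calculus_value_def by blast
qed

lemma functional_calculus_exists:
  assumes sa: "selfadjoint (x::'a::unital_cstar_algebra)"
  shows "\<exists>\<Phi>. is_functional_calculus x \<Phi>"
proof -
  define \<Phi> where "\<Phi> g = (THE y. calculus_value x g y)" for g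
  have val: "\<Phi> g = y" if "calculus_value x g y" for g y
    unfolding \<Phi>_def using that calculus_value_unique[OF sa] by blast
  have \<Phi>: "calculus_value x g (\<Phi> g)" if "continuous_on (spectrum x) g" for g
    using calculus_value_exists[OF sa that] val by metis
  have "is_functional_calculus x \<Phi>"
    unfolding is_functional_calculus_def
  proof (intro conjI allI impI)
    have p: "poly [:1::complex:] = (\<lambda>z. 1)" "poly [:0, 1::complex:] = (\<lambda>z. z)" by auto
    show "\<Phi> (\<lambda>z. 1) = 1"
      using val[OF calculus_value_poly[of x "[:1:]", unfolded p]] by (simp add: poly_elem_const)
    show "\<Phi> (\<lambda>z. z) = x"
      using val[OF calculus_value_poly[of x "[:0, 1:]", unfolded p]] by simp
  next
    fix g h :: "complex \<Rightarrow> complex"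
    assume g: "continuous_on (spectrum x) g" and h: "continuous_on (spectrum x) h"
    show "\<Phi> (\<lambda>z. g z + h z) = \<Phi> g + \<Phi> h" by (rule val calculus_value_add \<Phi> g h)+
    show "\<Phi> (\<lambda>z. g z * h z) = \<Phi> g * \<Phi> h" by (rule val calculus_value_mult \<Phi> g h)+
  next
    fix g :: "complex \<Rightarrow> complex" and c :: complex
    assume g: "continuous_on (spectrum x) g"
    show "\<Phi> (\<lambda>z. c * g z) = c *\<^sub>C \<Phi> g" by (rule val calculus_value_scaleC \<Phi> g)+
    show "\<Phi> (\<lambda>z. cnj (g z)) = star (\<Phi> g)" by (rule val calculus_value_star[OF sa] \<Phi> g)+
  next
    fix g :: "complex \<Rightarrow> complex" and M :: real
    assume "continuous_on (spectrum x) g" "0 \<le> M"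
    then show "norm (\<Phi> g) \<le> M \<longleftrightarrow> (\<forall>z\<in>spectrum x. cmod (g z) \<le> M)"
      by (intro calculus_value_norm_le_iff[OF sa] \<Phi>)
  qed
  then show ?thesis by blast
qed

lemma cfc_eq:
  assumes sa: "selfadjoint x" and g: "continuous_on (spectrum x) g" and y: "calculus_value x g y"
  shows "cfc g x = y"
  unfolding cfc_def
proof (rule the_equality)
  obtain \<Phi> where \<Phi>: "is_functional_calculus x \<Phi>" using functional_calculus_exists[OF sa] by blast
  then show "\<exists>\<Phi>. is_functional_calculus x \<Phi> \<and> y = \<Phi> g"
    using calculus_value_unique[OF sa y functional_calculus_value[OF sa \<Phi> g]] by blast
next
  fix z assume "\<exists>\<Phi>. is_functional_calculus x \<Phi> \<and> z = \<Phi> g"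
  then show "z = y" using calculus_value_unique[OF sa y] functional_calculus_value[OF sa _ g] by metis
qed

lemma calculus_value_cfc:
  assumes "selfadjoint x" "continuous_on (spectrum x) g"
  shows "calculus_value x g (cfc g x)"
  using calculus_value_exists[OF assms] cfc_eq[OF assms] by metis

text \<open>The real parts of the spectral values; for self-adjoint \<open>x\<close> this is the spectrum itself, as a
  subset of the real line, on which real functions are required to be continuous.\<close>

abbreviation real_spectrum :: "'a::unital_cstar_algebra \<Rightarrow> real set" where
  "real_spectrum x \<equiv> Re ` spectrum x"

lemma compact_real_spectrum: "compact (real_spectrum x)"
  by (intro compact_continuous_image continuous_intros compact_spectrum)

lemma continuous_on_spectrum_of_real:
  assumes "continuous_on (real_spectrum x) h"
  shows "continuous_on (spectrum x) (\<lambda>z. complex_of_real (h (Re z)))"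
  by (intro continuous_on_of_real continuous_on_compose2[OF assms] continuous_intros) simp

lemma calculus_value_cfc_real:
  assumes "selfadjoint x" "continuous_on (real_spectrum x) h"
  shows "calculus_value x (\<lambda>z. complex_of_real (h (Re z))) (cfc_real h x)"
  unfolding cfc_real_def
  by (rule calculus_value_cfc[OF assms(1) continuous_on_spectrum_of_real[OF assms(2)]])

lemma cfc_real_eqI:
  assumes "selfadjoint x" "continuous_on (real_spectrum x) h"
    and "calculus_value x g y" "\<And>z. z \<in> spectrum x \<Longrightarrow> g z = complex_of_real (h (Re z))"
  shows "cfc_real h x = y"
proof -
  have "calculus_value x (\<lambda>z. complex_of_real (h (Re z))) y"
    using assms(3,4) unfolding calculus_value_def by (simp cong: uniform_limit_cong')
  then show ?thesis
    using calculus_value_unique[OF assms(1)] calculus_value_cfc_real[OF assms(1,2)] by blast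
qed

lemma cfc_real_cong:
  assumes "selfadjoint x" "continuous_on (real_spectrum x) h"
    and "\<And>t. t \<in> real_spectrum x \<Longrightarrow> g t = h t"
  shows "cfc_real g x = cfc_real h x"
proof (rule cfc_real_eqI[OF assms(1) _ calculus_value_cfc_real[OF assms(1,2)]])
  show "continuous_on (real_spectrum x) g" using assms(2,3) by (simp cong: continuous_on_cong)
qed (use assms(3) in auto)

context
  fixes x :: "'a::unital_cstar_algebra"
  assumes sa: "selfadjoint x"
begin

lemma cfc_real_add:
  assumes "continuous_on (real_spectrum x) g" "continuous_on (real_spectrum x) h"
  shows "cfc_real (\<lambda>t. g t + h t) x = cfc_real g x + cfc_real h x"
  by (rule cfc_real_eqI[OF sa _ calculus_value_add])
     (auto intro!: calculus_value_cfc_real sa assms continuous_intros)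

lemma cfc_real_mult:
  assumes "continuous_on (real_spectrum x) g" "continuous_on (real_spectrum x) h"
  shows "cfc_real (\<lambda>t. g t * h t) x = cfc_real g x * cfc_real h x"
  by (rule cfc_real_eqI[OF sa continuous_on_mult[OF assms] calculus_value_mult
        [OF assms[THEN calculus_value_cfc_real[OF sa]] assms[THEN continuous_on_spectrum_of_real]]]) simp

lemma cfc_real_scale:
  assumes "continuous_on (real_spectrum x) g"
  shows "cfc_real (\<lambda>t. r * g t) x = r *\<^sub>R cfc_real g x"
  unfolding scaleC_of_real[symmetric]
  by (rule cfc_real_eqI[OF sa _ calculus_value_scaleC])
     (auto intro!: calculus_value_cfc_real sa assms continuous_intros)

lemma cfc_real_const: "cfc_real (\<lambda>t. r) x = r *\<^sub>R 1"
proof -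
  have "calculus_value x (poly [:complex_of_real r:]) (r *\<^sub>R 1)"
    using calculus_value_poly[of x "[:complex_of_real r:]"] by (simp only: poly_elem_const scaleC_of_real)
  then show ?thesis by (rule cfc_real_eqI[OF sa continuous_on_const]) simp
qed

lemma cfc_real_id: "cfc_real (\<lambda>t. t) x = x"
  by (rule cfc_real_eqI[OF sa _ calculus_value_poly[of x "[:0, 1:]", unfolded poly_elem_X]])
     (auto simp: spectrum_selfadjoint_of_real_Re[OF sa])

lemma cfc_real_diff:
  assumes "continuous_on (real_spectrum x) g" "continuous_on (real_spectrum x) h"
  shows "cfc_real (\<lambda>t. g t - h t) x = cfc_real g x - cfc_real h x"
  using cfc_real_add[OF assms(1) continuous_on_mult_left[OF assms(2), of "-1"]]
    cfc_real_scale[OF assms(2), of "-1"] by simp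

lemma cfc_real_affine: "cfc_real (\<lambda>t. r * t + s) x = r *\<^sub>R x + s *\<^sub>R 1"
  by (simp add: cfc_real_add cfc_real_scale cfc_real_id cfc_real_const continuous_intros)

lemma selfadjoint_cfc_real:
  assumes "continuous_on (real_spectrum x) g"
  shows "selfadjoint (cfc_real g x)"
  using cfc_real_eqI[OF sa assms calculus_value_star[OF sa calculus_value_cfc_real[OF sa assms]]]
  by (simp add: selfadjoint_def)

lemma cfc_real_commute:
  assumes "continuous_on (real_spectrum x) g" "u * x = x * u"
  shows "u * cfc_real g x = cfc_real g x * u"
  using calculus_value_commute[OF calculus_value_cfc_real[OF sa assms(1)] assms(2)] .

end


section \<open>Positive elements\<close>

lemma positive_elem_iff:
  "positive_elem x \<longleftrightarrow> selfadjoint x \<and> (\<forall>t\<in>real_spectrum x. 0 \<le> t)"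
proof (cases "selfadjoint x")
  case True
  then have "c \<in> complex_of_real ` {0..} \<longleftrightarrow> 0 \<le> Re c" if "c \<in> spectrum x" for c
    using spectrum_selfadjoint_of_real_Re[OF True that] by (metis Re_complex_of_real atLeast_iff image_iff)
  then show ?thesis using True by (auto simp: positive_elem_def)
qed (simp add: positive_elem_def)

lemma positive_elem_selfadjoint: "positive_elem x \<Longrightarrow> selfadjoint x"
  by (simp add: positive_elem_def)

lemma real_spectrum_shift:
  assumes "selfadjoint x"
  shows "t \<in> real_spectrum (x + r *\<^sub>R 1) \<longleftrightarrow> t - r \<in> real_spectrum (x::'a::unital_cstar_algebra)"
proof -
  have *: "t \<in> real_spectrum y \<longleftrightarrow> complex_of_real t \<in> spectrum y" if "selfadjoint y" for y :: 'a and t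
    using spectrum_selfadjoint_of_real_Re[OF that] by force
  have "selfadjoint (x + r *\<^sub>R 1)" using assms by (intro selfadjoint_add selfadjoint_scaleR) auto
  then show ?thesis
    using assms spectrum_add_scaleC_one[of "complex_of_real t" x "complex_of_real r"]
    by (simp add: * scaleC_of_real)
qed

lemma real_spectrum_minus: "t \<in> real_spectrum (- x) \<longleftrightarrow> - t \<in> real_spectrum (x::'a::unital_cstar_algebra)"
proof -
  have "- t \<in> Re ` spectrum y" if "t \<in> Re ` spectrum (- y)" for y :: 'a and t
    using that spectrum_minus[of _ y] by (force simp: image_iff)
  from this[of t x] this[of "-t" "-x"] show ?thesis by auto
qed

lemma positive_elem_shift:
  assumes "selfadjoint x"
  shows "positive_elem (x + r *\<^sub>R 1) \<longleftrightarrow> (\<forall>t\<in>real_spectrum x. - r \<le> t)"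
proof -
  have "selfadjoint (x + r *\<^sub>R 1)" using assms by (intro selfadjoint_add selfadjoint_scaleR) auto
  moreover have "(\<forall>t\<in>real_spectrum (x + r *\<^sub>R 1). 0 \<le> t) \<longleftrightarrow> (\<forall>t\<in>real_spectrum x. - r \<le> t)"
  proof safe
    fix t assume *: "\<forall>t\<in>real_spectrum (x + r *\<^sub>R 1). 0 \<le> t" and c: "t \<in> spectrum x"
    have "Re t + r \<in> real_spectrum (x + r *\<^sub>R 1)" unfolding real_spectrum_shift[OF assms] using c by auto
    then show "- r \<le> Re t" using * by force
  next
    fix t assume *: "\<forall>t\<in>real_spectrum x. - r \<le> t" and c: "t \<in> spectrum (x + r *\<^sub>R 1)"
    then have "Re t - r \<in> real_spectrum x" unfolding real_spectrum_shift[OF assms, symmetric] by blast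
    then show "0 \<le> Re t" using * by force
  qed
  ultimately show ?thesis by (simp add: positive_elem_iff)
qed

lemma real_spectrum_norm_le: "t \<in> real_spectrum x \<Longrightarrow> \<bar>t\<bar> \<le> norm x"
  using spectrum_norm_le abs_Re_le_cmod by (force intro: order_trans)

lemma norm_le_real_spectrum:
  assumes "selfadjoint x" "0 \<le> M" "\<And>t. t \<in> real_spectrum x \<Longrightarrow> \<bar>t\<bar> \<le> M"
  shows "norm x \<le> M"
proof (cases "x = 0")
  case False
  then obtain c where c: "c \<in> spectrum x" "cmod c = norm x"
    using selfadjoint_norm_attained assms(1) by blast
  then show ?thesis
    using assms(3)[of "Re c"] spectrum_selfadjoint_real[OF assms(1) c(1)] by (simp add: cmod_def)
qed (use assms in simp)

text \<open>A norm characterization of positivity; by the triangle inequality it makes the positive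
  elements closed under addition.\<close>

lemma positive_elem_norm_iff:
  assumes sa: "selfadjoint (x::'a::unital_cstar_algebra)"
  shows "positive_elem x \<longleftrightarrow> (\<exists>t\<ge>0. norm (x - t *\<^sub>R 1) \<le> t)"
proof
  assume pos: "positive_elem x"
  have "norm (x - norm x *\<^sub>R 1) \<le> norm x"
  proof (rule norm_le_real_spectrum)
    show "selfadjoint (x - norm x *\<^sub>R 1)" using sa by (intro selfadjoint_diff selfadjoint_scaleR) auto
    fix t assume "t \<in> real_spectrum (x - norm x *\<^sub>R 1)"
    then have "t + norm x \<in> real_spectrum x"
      using real_spectrum_shift[OF sa, of t "- norm x"] by simp
    then show "\<bar>t\<bar> \<le> norm x"
      using pos real_spectrum_norm_le[of "t + norm x" x] unfolding positive_elem_iff by force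
  qed simp
  then show "\<exists>t\<ge>0. norm (x - t *\<^sub>R 1) \<le> t" by (intro exI[of _ "norm x"]) simp
next
  assume "\<exists>t\<ge>0. norm (x - t *\<^sub>R 1) \<le> t"
  then obtain t where t: "norm (x - t *\<^sub>R 1) \<le> t" by blast
  have "0 \<le> s" if "s \<in> real_spectrum x" for s
  proof -
    have "s - t \<in> real_spectrum (x - t *\<^sub>R 1)"
      using real_spectrum_shift[OF sa, of "s - t" "- t"] that by simp
    then show ?thesis using real_spectrum_norm_le t by fastforce
  qed
  then show "positive_elem x" using sa by (simp add: positive_elem_iff)
qed

lemma positive_elem_add:
  assumes "positive_elem x" "positive_elem y"
  shows "positive_elem (x + y)"
proof -
  note sa = positive_elem_selfadjoint[OF assms(1)] positive_elem_selfadjoint[OF assms(2)]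
  obtain s t where st: "s \<ge> 0" "norm (x - s *\<^sub>R 1) \<le> s" "t \<ge> 0" "norm (y - t *\<^sub>R 1) \<le> t"
    using assms positive_elem_norm_iff sa by metis
  have eq: "x + y - (s + t) *\<^sub>R 1 = (x - s *\<^sub>R 1) + (y - t *\<^sub>R 1)" by (simp add: algebra_simps)
  have "norm (x + y - (s + t) *\<^sub>R 1) \<le> s + t"
    unfolding eq by (rule norm_triangle_mono[OF st(2,4)])
  then show ?thesis
    using positive_elem_norm_iff[OF selfadjoint_add[OF sa]] st by (metis add_nonneg_nonneg)
qed

lemma positive_elem_square:
  assumes sa: "selfadjoint (x::'a::unital_cstar_algebra)"
  shows "positive_elem (x * x)"
proof -
  have eq: "x * x = poly_elem [:0, 0, 1:] x" by (simp add: poly_elem_pCons)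
  have "0 \<le> Re c" if "c \<in> spectrum (x * x)" for c
  proof -
    obtain d where d: "d \<in> spectrum x" "c = d * d"
      using \<open>c \<in> spectrum (x * x)\<close> spectrum_poly_elem[OF sa, of "[:0, 0, 1:]"] by (auto simp: eq)
    then show ?thesis using spectrum_selfadjoint_real[OF sa d(1)] by simp
  qed
  then show ?thesis using sa by (auto simp: positive_elem_iff selfadjoint_mult)
qed

lemma positive_elem_cfc_real:
  assumes sa: "selfadjoint x" and h: "continuous_on (real_spectrum x) h"
    and nonneg: "\<And>t. t \<in> real_spectrum x \<Longrightarrow> 0 \<le> h t"
  shows "positive_elem (cfc_real h x)"
proof -
  have cont: "continuous_on (real_spectrum x) (\<lambda>t. sqrt (h t))" by (intro continuous_intros h)
  have "cfc_real h x = cfc_real (\<lambda>t. sqrt (h t) * sqrt (h t)) x"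
    using nonneg by (intro cfc_real_cong[OF sa] continuous_intros h) auto
  also have "\<dots> = cfc_real (\<lambda>t. sqrt (h t)) x * cfc_real (\<lambda>t. sqrt (h t)) x"
    by (rule cfc_real_mult[OF sa cont cont])
  finally show ?thesis using positive_elem_square[OF selfadjoint_cfc_real[OF sa cont]] by simp
qed

lemma positive_elem_sqrt:
  assumes "positive_elem (x::'a::unital_cstar_algebra)"
  obtains r where "selfadjoint r" "r * r = x" "\<And>u. u * x = x * u \<Longrightarrow> u * r = r * u"
proof
  have sa: "selfadjoint x" using assms by (rule positive_elem_selfadjoint)
  have cont: "continuous_on (real_spectrum x) sqrt" by (intro continuous_intros)
  show "selfadjoint (cfc_real sqrt x)" by (rule selfadjoint_cfc_real[OF sa cont])
  have "cfc_real sqrt x * cfc_real sqrt x = cfc_real (\<lambda>t. sqrt t * sqrt t) x"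
    by (rule cfc_real_mult[OF sa cont cont, symmetric])
  also have "\<dots> = cfc_real (\<lambda>t. t) x"
    using assms by (intro cfc_real_cong[OF sa]) (auto simp: positive_elem_iff)
  finally show "cfc_real sqrt x * cfc_real sqrt x = x" by (simp add: cfc_real_id[OF sa])
  show "u * cfc_real sqrt x = cfc_real sqrt x * u" if "u * x = x * u" for u
    by (rule cfc_real_commute[OF sa cont that])
qed

lemma positive_elem_mult_commuting:
  assumes "positive_elem (x::'a::unital_cstar_algebra)" "positive_elem y" "x * y = y * x"
  shows "positive_elem (x * y)"
proof -
  obtain r where r: "selfadjoint r" "r * r = x" "\<And>u. u * x = x * u \<Longrightarrow> u * r = r * u"
    using positive_elem_sqrt[OF assms(1)] by blast
  obtain s where s: "selfadjoint s" "s * s = y" "\<And>u. u * y = y * u \<Longrightarrow> u * s = s * u"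
    using positive_elem_sqrt[OF assms(2)] by blast
  have "y * r = r * y" using r(3) assms(3) by simp
  then have rs: "r * s = s * r" using s(3) by simp
  have "x * y = (r * s) * (r * s)" unfolding r(2)[symmetric] s(2)[symmetric] by (metis mult.assoc rs)
  then show ?thesis using positive_elem_square[OF selfadjoint_mult[OF r(1) s(1) rs]] by simp
qed

lemma positive_elem_scaleR:
  assumes "positive_elem (x::'a::unital_cstar_algebra)" "0 \<le> r"
  shows "positive_elem (r *\<^sub>R x)"
proof -
  have sa: "selfadjoint x" using assms(1) by (rule positive_elem_selfadjoint)
  have "positive_elem (cfc_real (\<lambda>t. r * t + 0) x)"
    using assms by (intro positive_elem_cfc_real sa continuous_intros) (auto simp: positive_elem_iff)
  then show ?thesis unfolding cfc_real_affine[OF sa] by simp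
qed

lemma positive_elem_one: "positive_elem (1::'a::unital_cstar_algebra)"
  using positive_elem_square[OF selfadjoint_one[where 'a = 'a]] by simp

lemma positive_elem_zero: "positive_elem (0::'a::unital_cstar_algebra)"
  using positive_elem_scaleR[OF positive_elem_one[where 'a = 'a], of 0] by simp

lemma positive_elem_closed:
  assumes "selfadjoint x" "\<And>e. e > 0 \<Longrightarrow> positive_elem (x + e *\<^sub>R 1)"
  shows "positive_elem x"
proof -
  have "0 \<le> t" if "t \<in> real_spectrum x" for t
  proof (rule field_le_epsilon)
    fix e :: real assume "e > 0"
    then have "\<forall>t\<in>real_spectrum x. - e \<le> t" using assms positive_elem_shift by blast
    then have "- e \<le> t" using that by blast
    then show "0 \<le> t + e" by simp
  qed
  then show ?thesis using assms(1) by (simp add: positive_elem_iff)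
qed

section \<open>Pointwise domination in a commutative setting\<close>

text \<open>The role of characters of the commutative algebra generated by \<open>b\<close> and \<open>c\<close> is played by
  nonnegative weights. Put \<open>d = c - f(b) + \<epsilon>\<close>. A function \<open>h\<close> with \<open>h(b) \<le> c\<close> and \<open>h(s) \<ge> f(s)\<close>
  yields the weight \<open>w = max 0 (\<epsilon> - (f - h))\<close>, positive near \<open>s\<close>, for which
  \<open>w(b) d = w(b) (c - h(b)) + (w (h - f + \<epsilon>))(b)\<close> is positive. By compactness a finite sum
  of such weights is positive on the whole spectrum, hence gives an invertible factor.\<close>

lemma cfc_real_le_commuting:
  assumes b: "selfadjoint b" and c: "selfadjoint c" and comm: "c * b = b * c"
    and f: "continuous_on (real_spectrum b) f"
    and minorant: "\<And>s. s \<in> real_spectrum b \<Longrightarrow>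
      \<exists>h. continuous_on (real_spectrum b) h \<and> f s \<le> h s \<and> positive_elem (c - cfc_real h b)"
  shows "positive_elem (c - cfc_real f b)"
proof (rule positive_elem_closed)
  let ?S = "real_spectrum b"
  note sa = selfadjoint_cfc_real[OF b]
  show "selfadjoint (c - cfc_real f b)" by (intro selfadjoint_diff c sa f)
  fix e :: real assume e: "e > 0"
  define d where "d = c - cfc_real f b + e *\<^sub>R 1"
  have "b * cfc_real f b = cfc_real f b * b" by (rule cfc_real_commute[OF b f refl])
  then have db: "d * b = b * d" using comm by (simp add: d_def algebra_simps)
  define weight where "weight w \<longleftrightarrow> continuous_on ?S w \<and> (\<forall>t\<in>?S. 0 \<le> w t) \<and>
      positive_elem (cfc_real w b * d)" for w
  have local_weight: "\<exists>w U. weight w \<and> open U \<and> s \<in> U \<and> (\<forall>t\<in>?S \<inter> U. 0 < w t)" if s: "s \<in> ?S" for s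
  proof -
    obtain h where h: "continuous_on ?S h" "f s \<le> h s" "positive_elem (c - cfc_real h b)"
      using minorant[OF s] by blast
    define v where "v t = h t - f t + e" for t
    define w where "w t = max 0 (v t)" for t
    have v: "continuous_on ?S v" unfolding v_def by (intro continuous_intros h f)
    have w: "continuous_on ?S w" unfolding w_def by (intro continuous_intros v)
    have "cfc_real v b = cfc_real h b - cfc_real f b + e *\<^sub>R 1"
      unfolding v_def
      by (simp add: cfc_real_add[OF b] cfc_real_diff[OF b] cfc_real_const[OF b] h f continuous_intros)
    then have "d = (c - cfc_real h b) + cfc_real v b" by (simp add: d_def)
    then have split: "cfc_real w b * d = cfc_real w b * (c - cfc_real h b) + cfc_real (\<lambda>t. w t * v t) b"
      by (simp only: distrib_left cfc_real_mult[OF b w v])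
    have "positive_elem (cfc_real w b * (c - cfc_real h b))"
    proof (rule positive_elem_mult_commuting)
      show "positive_elem (cfc_real w b)"
        by (rule positive_elem_cfc_real[OF b w]) (simp add: w_def)
      have "(c - cfc_real h b) * b = b * (c - cfc_real h b)"
        using cfc_real_commute[OF b h(1) refl] comm by (simp add: algebra_simps)
      from cfc_real_commute[OF b w this]
      show "cfc_real w b * (c - cfc_real h b) = (c - cfc_real h b) * cfc_real w b" by simp
    qed (rule h(3))
    moreover have "positive_elem (cfc_real (\<lambda>t. w t * v t) b)"
      by (rule positive_elem_cfc_real[OF b continuous_on_mult[OF w v]]) (simp add: w_def max_def)
    ultimately have "positive_elem (cfc_real w b * d)" unfolding split by (rule positive_elem_add)
    then have "weight w" using w by (simp add: weight_def w_def)
    moreover obtain U where U: "open U" "U \<inter> ?S = w -` {0<..} \<inter> ?S"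
      using w open_greaterThan unfolding continuous_on_open_invariant by blast
    have "s \<in> U" "\<forall>t\<in>?S \<inter> U. 0 < w t" using U(2) s h(2) e by (auto simp: w_def v_def)
    ultimately show ?thesis using U(1) by blast
  qed
  have "\<exists>p. \<forall>s\<in>?S. weight (fst (p s)) \<and> open (snd (p s)) \<and> s \<in> snd (p s) \<and>
      (\<forall>t\<in>?S \<inter> snd (p s). 0 < fst (p s) t)"
    by (rule bchoice) (use local_weight in simp)
  then obtain p where p: "\<And>s. s \<in> ?S \<Longrightarrow> weight (fst (p s)) \<and> open (snd (p s)) \<and> s \<in> snd (p s) \<and>
      (\<forall>t\<in>?S \<inter> snd (p s). 0 < fst (p s) t)"
    by blast
  define w U where "w s = fst (p s)" and "U s = snd (p s)" for s
  have wU: "\<And>s. s \<in> ?S \<Longrightarrow> weight (w s)" "\<And>s. s \<in> ?S \<Longrightarrow> open (U s)"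
    "\<And>s. s \<in> ?S \<Longrightarrow> s \<in> U s" "\<And>s t. s \<in> ?S \<Longrightarrow> t \<in> ?S \<Longrightarrow> t \<in> U s \<Longrightarrow> 0 < w s t"
    using p unfolding w_def U_def by blast+
  have "?S \<subseteq> \<Union> (U ` ?S)" using wU(3) by blast
  then obtain T where T: "T \<subseteq> ?S" "finite T" "?S \<subseteq> \<Union> (U ` T)"
    using compactE_image[OF compact_real_spectrum, of ?S U b] wU(2) by blast
  define W where "W t = (\<Sum>s\<in>T. w s t)" for t
  have "weight (\<lambda>t. \<Sum>s\<in>T. w s t)" using T(2,1)
  proof (induction T)
    case empty
    then show ?case
      using cfc_real_const[OF b, of 0] positive_elem_zero by (simp add: weight_def)
  next
    case (insert s F)
    then have "weight (w s)" "weight (\<lambda>t. \<Sum>s\<in>F. w s t)" using wU(1) by auto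
    then have "weight (\<lambda>t. w s t + (\<Sum>s\<in>F. w s t))"
      by (auto simp: weight_def cfc_real_add[OF b] distrib_right
          intro!: positive_elem_add continuous_on_add)
    then show ?case using insert.hyps by simp
  qed
  then have W: "continuous_on ?S W" "positive_elem (cfc_real W b * d)"
    by (simp_all add: weight_def W_def[abs_def])
  have Wpos: "0 < W t" if t: "t \<in> ?S" for t
  proof -
    obtain s where "s \<in> T" "t \<in> U s" using T(3) t by blast
    then show ?thesis unfolding W_def
      using wU(1,4) T t by (intro sum_pos2[of T s]) (auto simp: weight_def)
  qed
  define V where "V t = 1 / W t" for t
  have V: "continuous_on ?S V" unfolding V_def
    by (intro continuous_intros W) (use Wpos in force)
  have "cfc_real V b * cfc_real W b = cfc_real (\<lambda>t. V t * W t) b"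
    by (rule cfc_real_mult[OF b V W(1), symmetric])
  also have "\<dots> = cfc_real (\<lambda>t. 1) b"
    by (rule cfc_real_cong[OF b continuous_on_const]) (use Wpos in \<open>force simp: V_def\<close>)
  finally have VW: "cfc_real V b * cfc_real W b = 1" by (simp add: cfc_real_const[OF b])
  have dV: "d * cfc_real V b = cfc_real V b * d" by (rule cfc_real_commute[OF b V db])
  have dW: "d * cfc_real W b = cfc_real W b * d" by (rule cfc_real_commute[OF b W(1) db])
  have WV: "cfc_real W b * cfc_real V b = cfc_real V b * cfc_real W b"
    using cfc_real_mult[OF b V W(1)] cfc_real_mult[OF b W(1) V] by (simp add: mult.commute)
  have "positive_elem (cfc_real V b * (cfc_real W b * d))"
  proof (rule positive_elem_mult_commuting)
    show "positive_elem (cfc_real V b)"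
      by (rule positive_elem_cfc_real[OF b V]) (use Wpos in \<open>force simp: V_def\<close>)
    show "cfc_real V b * (cfc_real W b * d) = cfc_real W b * d * cfc_real V b"
      by (metis WV dV mult.assoc)
  qed (rule W(2))
  then show "positive_elem (c - cfc_real f b + e *\<^sub>R 1)"
    by (simp only: mult.assoc[symmetric] VW mult_1_left d_def)
qed


section \<open>Positive maps and convex functions\<close>

lemma convex_on_supporting_line:
  fixes f :: "real \<Rightarrow> real"
  assumes "open I" "convex_on I f" "s \<in> I"
  shows "\<exists>m. \<forall>t\<in>I. f s + m * (t - s) \<le> f t"
  using convex_le_Inf_differential[OF assms(2), of s] assms(1,3) by (auto simp: interior_open)

context
  fixes \<phi> :: "'a::unital_cstar_algebra \<Rightarrow> 'b::unital_cstar_algebra"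
  assumes lin: "complex_linear \<phi>" and pos: "positive_map \<phi>"
begin

lemma map_add: "\<phi> (x + y) = \<phi> x + \<phi> y"
  and map_scaleR: "\<phi> (r *\<^sub>R x) = r *\<^sub>R \<phi> x"
  using lin unfolding complex_linear_def by (simp_all flip: scaleC_of_real)

lemma map_minus: "\<phi> (- x) = - \<phi> x"
  using map_scaleR[of "-1" x] by simp

lemma map_diff: "\<phi> (x - y) = \<phi> x - \<phi> y"
  using map_add[of x "- y"] by (simp add: map_minus)

lemma map_positive: "positive_elem x \<Longrightarrow> positive_elem (\<phi> x)"
  using pos by (simp add: positive_map_def)

text \<open>A self-adjoint element is the difference of the positive elements \<open>x + \<parallel>x\<parallel>\<close> and \<open>\<parallel>x\<parallel>\<close>.\<close>

lemma map_selfadjoint: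
  assumes "selfadjoint x"
  shows "selfadjoint (\<phi> x)"
proof -
  have "positive_elem (x + norm x *\<^sub>R 1)"
    using positive_elem_shift[OF assms, of "norm x"] real_spectrum_norm_le[of _ x] by force
  then have "selfadjoint (\<phi> (x + norm x *\<^sub>R 1) - norm x *\<^sub>R \<phi> 1)"
    by (intro selfadjoint_diff selfadjoint_scaleR positive_elem_selfadjoint map_positive positive_elem_one)
  then show ?thesis by (simp add: map_add map_scaleR)
qed

lemma positive_scaleR_diff_map_one:
  assumes "\<phi> 1 = 1 \<or> r \<le> 0 \<and> positive_elem (1 - \<phi> 1)"
  shows "positive_elem (r *\<^sub>R \<phi> 1 - r *\<^sub>R 1)"
proof (cases "\<phi> 1 = 1")
  case False
  then have "positive_elem ((- r) *\<^sub>R (1 - \<phi> 1))" using assms by (intro positive_elem_scaleR) auto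
  then show ?thesis by (simp add: scaleR_diff_right)
qed (simp add: positive_elem_zero)

text \<open>By compactness the strict lower bound \<open>t\<close> can be raised to some \<open>r > t\<close>, with \<open>r \<le> 0\<close> in the
  contractive case, and \<open>\<phi>(a) \<ge> r \<phi>(1) \<ge> r\<close> follows. The spectrum of \<open>a\<close> may be empty, in the zero
  algebra.\<close>

lemma map_spectrum_above:
  assumes a: "selfadjoint a" and above: "\<forall>s\<in>real_spectrum a. t < s"
    and one: "\<phi> 1 = 1 \<or> t < 0 \<and> positive_elem (1 - \<phi> 1)"
  shows "t \<notin> real_spectrum (\<phi> a)"
proof -
  obtain r0 where r0: "t < r0" "\<forall>s\<in>real_spectrum a. r0 \<le> s"
  proof (cases "real_spectrum a = {}")
    case True
    then show ?thesis using that[of "t + 1"] by auto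
  next
    case False
    then obtain r where "r \<in> real_spectrum a" "\<forall>s\<in>real_spectrum a. r \<le> s"
      using compact_attains_inf[OF compact_real_spectrum] by blast
    then show ?thesis using that above by blast
  qed
  define r where "r = (if \<phi> 1 = 1 then r0 else min r0 0)"
  have r: "t < r" "\<forall>s\<in>real_spectrum a. r \<le> s" "\<phi> 1 = 1 \<or> r \<le> 0 \<and> positive_elem (1 - \<phi> 1)"
    using r0 one by (auto simp: r_def)
  have "positive_elem (a + (- r) *\<^sub>R 1)" unfolding positive_elem_shift[OF a] using r(2) by simp
  from map_positive[OF this] have "positive_elem (\<phi> a - r *\<^sub>R \<phi> 1)"
    by (simp add: map_diff map_scaleR)
  from positive_elem_add[OF this positive_scaleR_diff_map_one[OF r(3)]]
  have "positive_elem (\<phi> a + (- r) *\<^sub>R 1)" by simp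
  then have "\<forall>s\<in>real_spectrum (\<phi> a). r \<le> s"
    unfolding positive_elem_shift[OF map_selfadjoint[OF a]] by simp
  then show ?thesis using r(1) by force
qed

lemma map_spectrum_subset:
  assumes a: "selfadjoint a" and I: "is_interval I" "real_spectrum a \<subseteq> I"
    and one: "\<phi> 1 = 1 \<or> 0 \<in> I \<and> positive_elem (1 - \<phi> 1)"
  shows "real_spectrum (\<phi> a) \<subseteq> I"
proof
  fix t assume t: "t \<in> real_spectrum (\<phi> a)"
  show "t \<in> I"
  proof (rule ccontr)
    assume nt: "t \<notin> I"
    then consider "\<forall>s\<in>I. t < s" | "\<forall>s\<in>I. s < t"
      using mem_is_interval_1_I[OF I(1)] by (metis linorder_not_less)
    then show False
    proof cases
      case 1
      then show ?thesis using map_spectrum_above[OF a, of t] I(2) one t by blast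
    next
      case 2
      \<comment> \<open>Upper bounds reduce to lower bounds for \<open>- a\<close>.\<close>
      have "\<forall>s\<in>real_spectrum (- a). - t < s"
        using 2 I(2) unfolding real_spectrum_minus by (metis minus_less_iff real_spectrum_minus subsetD)
      moreover have "\<phi> 1 = 1 \<or> - t < 0 \<and> positive_elem (1 - \<phi> 1)" using one 2 by auto
      ultimately have "- t \<notin> real_spectrum (\<phi> (- a))"
        by (rule map_spectrum_above[OF selfadjoint_minus[OF a]])
      then show ?thesis using t unfolding map_minus real_spectrum_minus minus_minus by blast
    qed
  qed
qed

lemma positive_map_convex_ineq:
  assumes I: "open I" "is_interval I" and f: "convex_on I f"
    and a: "selfadjoint a" "real_spectrum a \<subseteq> I"
    and comm: "\<phi> a * \<phi> (cfc_real f a) = \<phi> (cfc_real f a) * \<phi> a"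
    and one: "\<phi> 1 = 1 \<or> 0 \<in> I \<and> f 0 \<le> 0 \<and> positive_elem (1 - \<phi> 1)"
  shows "cfc_real f (\<phi> a) \<preceq> \<phi> (cfc_real f a)"
proof -
  have b: "selfadjoint (\<phi> a)" by (rule map_selfadjoint[OF a(1)])
  have bI: "real_spectrum (\<phi> a) \<subseteq> I" using map_spectrum_subset[OF a(1) I(2) a(2)] one by blast
  have cont: "continuous_on I f" by (rule convex_on_continuous[OF I(1) f])
  note fa = continuous_on_subset[OF cont a(2)] and fb = continuous_on_subset[OF cont bI]
  have c: "selfadjoint (\<phi> (cfc_real f a))" by (intro map_selfadjoint selfadjoint_cfc_real a fa)
  have "positive_elem (\<phi> (cfc_real f a) - cfc_real f (\<phi> a))"
  proof (rule cfc_real_le_commuting[OF b c comm[symmetric] fb])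
    fix s assume "s \<in> real_spectrum (\<phi> a)"
    then obtain m where m: "\<And>t. t \<in> I \<Longrightarrow> f s + m * (t - s) \<le> f t"
      using convex_on_supporting_line[OF I(1) f] bI by blast
    define k where "k = f s - m * s"
    have below: "m * t + k \<le> f t" if "t \<in> I" for t using m[OF that] by (simp add: k_def algebra_simps)
    have h: "continuous_on X (\<lambda>t. m * t + k)" for X :: "real set" by (intro continuous_intros)
    have "positive_elem (cfc_real (\<lambda>t. f t - (m * t + k)) a)"
      by (rule positive_elem_cfc_real[OF a(1)])
         (use below a(2) in \<open>auto intro!: continuous_on_diff fa h\<close>)
    then have "positive_elem (cfc_real f a - (m *\<^sub>R a + k *\<^sub>R 1))"
      by (simp add: cfc_real_diff[OF a(1) fa h] cfc_real_affine[OF a(1)])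
    from map_positive[OF this]
    have "positive_elem (\<phi> (cfc_real f a) - (m *\<^sub>R \<phi> a + k *\<^sub>R \<phi> 1))"
      by (simp add: map_diff map_add map_scaleR)
    moreover have "\<phi> 1 = 1 \<or> k \<le> 0 \<and> positive_elem (1 - \<phi> 1)"
      using one below[of 0] by auto
    ultimately have "positive_elem (\<phi> (cfc_real f a) - (m *\<^sub>R \<phi> a + k *\<^sub>R \<phi> 1) + (k *\<^sub>R \<phi> 1 - k *\<^sub>R 1))"
      by (intro positive_elem_add positive_scaleR_diff_map_one)
    moreover have "\<phi> (cfc_real f a) - (m *\<^sub>R \<phi> a + k *\<^sub>R \<phi> 1) + (k *\<^sub>R \<phi> 1 - k *\<^sub>R 1)
        = \<phi> (cfc_real f a) - cfc_real (\<lambda>t. m * t + k) (\<phi> a)"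
      unfolding cfc_real_affine[OF b] by simp
    ultimately have "positive_elem (\<phi> (cfc_real f a) - cfc_real (\<lambda>t. m * t + k) (\<phi> a))"
      by simp
    then show "\<exists>h. continuous_on (real_spectrum (\<phi> a)) h \<and> f s \<le> h s \<and>
        positive_elem (\<phi> (cfc_real f a) - cfc_real h (\<phi> a))"
      by (intro exI[of _ "\<lambda>t. m * t + k"]) (auto simp: k_def intro!: continuous_intros)
  qed
  then show ?thesis using c selfadjoint_cfc_real[OF b fb] by (simp add: cstar_le_def)
qed

lemma contractive_one_minus_map_one:
  assumes "contractive \<phi>"
  shows "positive_elem (1 - \<phi> 1)"
proof -
  have "norm (\<phi> 1) \<le> onorm \<phi> * norm (1::'a)"
    using assms by (intro onorm) (simp add: contractive_def)
  also have "\<dots> \<le> 1 * 1"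
    using assms norm_one_le by (intro mult_mono) (auto simp: contractive_def)
  finally have n: "norm (- \<phi> 1) \<le> 1" by simp
  have sa: "selfadjoint (- \<phi> 1)" by (intro selfadjoint_minus map_selfadjoint selfadjoint_one)
  have "positive_elem (- \<phi> 1 + 1 *\<^sub>R 1)"
    unfolding positive_elem_shift[OF sa] using real_spectrum_norm_le[of _ "- \<phi> 1"] n by force
  then show ?thesis by simp
qed

end

theorem theorem3p6:
  fixes \<phi> :: "'a::unital_cstar_algebra \<Rightarrow> 'b::unital_cstar_algebra"
    and f :: "real \<Rightarrow> real" and I :: "real set" and a :: 'a
  assumes "open I" and "is_interval I" and "convex_on I f"
    and "complex_linear \<phi>" and "positive_map \<phi>"
    and "selfadjoint a" and "spectrum a \<subseteq> complex_of_real ` I"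
    and "\<phi> a * \<phi> (cfc_real f a) = \<phi> (cfc_real f a) * \<phi> a"
  shows "(\<phi> 1 = 1 \<longrightarrow> cfc_real f (\<phi> a) \<preceq> \<phi> (cfc_real f a)) \<and>
    (0 \<in> I \<and> f 0 \<le> 0 \<and> contractive \<phi> \<longrightarrow> cfc_real f (\<phi> a) \<preceq> \<phi> (cfc_real f a))"
proof -
  have "real_spectrum a \<subseteq> I" using assms(7) by auto
  note ineq = positive_map_convex_ineq[OF assms(4,5,1,2,3,6) this assms(8)]
  show ?thesis using ineq contractive_one_minus_map_one[OF assms(4,5)] by blast
qed

end
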